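(* Let $X$ be a complex Banach space, $Y$ an $s$-concave Banach lattice with $2\le s<\infty$, and $U:X\to Y$ a $(t,1)$-summing operator with $1\le t\le s$. Then there is a constant $C>0$ (independent of $n$, $m$ and the polynomial) such that for every $n,m\in\mathbb N$, every Banach space $Z=(\mathbb C^n,\|\cdot\|)$ whose canonical basis is normalized $1$-unconditional, every $m$-homogeneous polynomial $P(z)=\sum_{|\alpha|=m}a_\alpha z^\alpha$ with $a_\alpha\in X$, and every $z\in B_Z$, $$\Big(\sum_{|\alpha|=m}\|U(a_\alpha)z^\alpha\|_Y^\beta\Big)^{1/\beta}\le C^m\|P\|_{B_Z,X},\qquad \beta=\frac{mst}{s+(m-1)t},$$ where $\|P\|_{B_Z,X}=\sup_{w\in B_Z}\|P(w)\|_X$.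
   Context: $U:X\to Y$ is $(r,t)$-summing if there is $C$ with $(\sum_k\|Uw_k\|^r)^{1/r}\le C\sup_{\phi\in B_{X^*}}(\sum_k|\phi(w_k)|^t)^{1/t}$ for all finite families $w_k\in X$. A Banach lattice $Y$ is $s$-concave if $(\sum_k\|y_k\|^s)^{1/s}\le M\|(\sum_k|y_k|^s)^{1/s}\|$ for all finite families. $B_Z$ is the open unit ball of $Z$. *)

theory Defs
  imports "HOL-Analysis.Analysis"
begin

text \<open>The library has no class of complex normed spaces.  A complex Banach space is
modelled as a real Banach space together with the operator J (multiplication by i):
J is real-linear, J (J x) = - x, and the norm is invariant under rotations e^{i theta}.\<close>

definition complex_structure :: "('x::real_normed_vector \<Rightarrow> 'x) \<Rightarrow> bool" where
  "complex_structure J \<longleftrightarrow> linear J \<and> (\<forall>x. J (J x) = - x) \<and>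
     (\<forall>x \<theta>. norm (cos \<theta> *\<^sub>R x + sin \<theta> *\<^sub>R J x) = norm x)"

definition cscale :: "('x::real_vector \<Rightarrow> 'x) \<Rightarrow> complex \<Rightarrow> 'x \<Rightarrow> 'x" where
  "cscale J c x = Re c *\<^sub>R x + Im c *\<^sub>R J x"

definition dual_ball :: "('x::real_normed_vector \<Rightarrow> 'x) \<Rightarrow> ('x \<Rightarrow> complex) set" where
  "dual_ball J = {\<phi>. linear \<phi> \<and> (\<forall>x. \<phi> (J x) = \<i> * \<phi> x) \<and> (\<forall>x. cmod (\<phi> x) \<le> norm x)}"

definition lat_abs :: "'r::{lattice, uminus} \<Rightarrow> 'r" where
  "lat_abs x = sup x (- x)"

definition banach_lattice :: "('r::{banach, ordered_real_vector, lattice}) itself \<Rightarrow> bool" where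
  "banach_lattice TYPE('r) \<longleftrightarrow>
     (\<forall>x y :: 'r. lat_abs x \<le> lat_abs y \<longrightarrow> norm x \<le> norm y)"

definition is_lub :: "'r::order set \<Rightarrow> 'r \<Rightarrow> bool" where
  "is_lub A z \<longleftrightarrow> (\<forall>a\<in>A. a \<le> z) \<and> (\<forall>u. (\<forall>a\<in>A. a \<le> u) \<longrightarrow> z \<le> u)"

text \<open>The lattice expression (\<Sum>k<N. |y_k|^s)^{1/s} (Lindenstrauss--Tzafriri 1.d):
it is the supremum of all \<Sum> a_k y_k with \<Sum> |a_k|^{s'} \<le> 1, s' = s/(s-1).
Here z is that supremum.\<close>
definition lat_psum :: "real \<Rightarrow> nat \<Rightarrow> (nat \<Rightarrow> 'r::{ordered_real_vector, lattice}) \<Rightarrow> 'r \<Rightarrow> bool" where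
  "lat_psum s N y z \<longleftrightarrow>
     is_lub {(\<Sum>k<N. a k *\<^sub>R y k) | a. (\<Sum>k<N. \<bar>a k\<bar> powr (s / (s - 1))) \<le> 1} z"

definition s_concave :: "real \<Rightarrow> ('r::{banach, ordered_real_vector, lattice}) itself \<Rightarrow> bool" where
  "s_concave s TYPE('r) \<longleftrightarrow> (\<exists>M. \<forall>N (y :: nat \<Rightarrow> 'r) z. lat_psum s N y z \<longrightarrow>
       (\<Sum>k<N. norm (y k) powr s) powr (1 / s) \<le> M * norm z)"

text \<open>The complex Banach lattice Y_C = Y + iY is represented by pairs (x, y);
complex scalar multiplication and the modulus |x + iy| = sup_theta (cos theta x + sin theta y),
with norm || |x + iy| ||.\<close>

definition cmul :: "complex \<Rightarrow> 'r \<times> 'r \<Rightarrow> ('r::real_vector) \<times> 'r" where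
  "cmul c p = (Re c *\<^sub>R fst p - Im c *\<^sub>R snd p, Im c *\<^sub>R fst p + Re c *\<^sub>R snd p)"

definition cmodulus :: "'r \<times> 'r \<Rightarrow> 'r::{ordered_real_vector, lattice}" where
  "cmodulus p = (THE z. is_lub {cos \<theta> *\<^sub>R fst p + sin \<theta> *\<^sub>R snd p | \<theta>. True} z)"

definition cnorm :: "('r::{banach, ordered_real_vector, lattice}) \<times> 'r \<Rightarrow> real" where
  "cnorm p = norm (cmodulus p)"

definition summing :: "real \<Rightarrow> real \<Rightarrow> ('x::real_normed_vector \<Rightarrow> 'x)
    \<Rightarrow> ('x \<Rightarrow> ('r::{banach, ordered_real_vector, lattice}) \<times> 'r) \<Rightarrow> bool" where
  "summing r t J U \<longleftrightarrow> (\<exists>C. \<forall>N (w :: nat \<Rightarrow> 'x).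
     (\<Sum>k<N. cnorm (U (w k)) powr r) powr (1 / r)
       \<le> C * (SUP \<phi>\<in>dual_ball J. (\<Sum>k<N. cmod (\<phi> (w k)) powr t) powr (1 / t)))"

definition bounded_clinear_op :: "('x::real_normed_vector \<Rightarrow> 'x)
    \<Rightarrow> ('x \<Rightarrow> ('r::{banach, ordered_real_vector, lattice}) \<times> 'r) \<Rightarrow> bool" where
  "bounded_clinear_op J U \<longleftrightarrow> linear U \<and> (\<forall>x. U (J x) = cmul \<i> (U x)) \<and>
     (\<exists>K. \<forall>x. cnorm (U x) \<le> K * norm x)"

definition cvecs :: "nat \<Rightarrow> (nat \<Rightarrow> complex) set" where
  "cvecs n = {z. \<forall>i\<ge>n. z i = 0}"

definition unit_vec :: "nat \<Rightarrow> nat \<Rightarrow> complex" where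
  "unit_vec i = (\<lambda>j. if j = i then 1 else 0)"

definition unconditional_norm :: "nat \<Rightarrow> ((nat \<Rightarrow> complex) \<Rightarrow> real) \<Rightarrow> bool" where
  "unconditional_norm n N \<longleftrightarrow>
     (\<forall>z\<in>cvecs n. \<forall>w\<in>cvecs n. N (\<lambda>i. z i + w i) \<le> N z + N w) \<and>
     (\<forall>z\<in>cvecs n. \<forall>c. N (\<lambda>i. c * z i) = cmod c * N z) \<and>
     (\<forall>z\<in>cvecs n. N z = 0 \<longrightarrow> z = (\<lambda>i. 0)) \<and>
     (\<forall>i<n. N (unit_vec i) = 1) \<and>
     (\<forall>z\<in>cvecs n. \<forall>\<mu>. (\<forall>i. cmod (\<mu> i) \<le> 1) \<longrightarrow> N (\<lambda>i. \<mu> i * z i) \<le> N z)"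

definition multi_indices :: "nat \<Rightarrow> nat \<Rightarrow> (nat \<Rightarrow> nat) set" where
  "multi_indices n m = {\<alpha>. (\<forall>i\<ge>n. \<alpha> i = 0) \<and> (\<Sum>i<n. \<alpha> i) = m}"

definition monom :: "nat \<Rightarrow> (nat \<Rightarrow> nat) \<Rightarrow> (nat \<Rightarrow> complex) \<Rightarrow> complex" where
  "monom n \<alpha> z = (\<Prod>i<n. z i ^ \<alpha> i)"

definition hpoly :: "('x::real_vector \<Rightarrow> 'x) \<Rightarrow> nat \<Rightarrow> nat \<Rightarrow> ((nat \<Rightarrow> nat) \<Rightarrow> 'x)
    \<Rightarrow> (nat \<Rightarrow> complex) \<Rightarrow> 'x" where
  "hpoly J n m a z = (\<Sum>\<alpha>\<in>multi_indices n m. cscale J (monom n \<alpha> z) (a \<alpha>))"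

definition open_ball_Z :: "nat \<Rightarrow> ((nat \<Rightarrow> complex) \<Rightarrow> real) \<Rightarrow> (nat \<Rightarrow> complex) set" where
  "open_ball_Z n N = {z\<in>cvecs n. N z < 1}"

definition poly_sup_norm :: "nat \<Rightarrow> ((nat \<Rightarrow> complex) \<Rightarrow> real) \<Rightarrow> ('x::real_normed_vector \<Rightarrow> 'x)
    \<Rightarrow> nat \<Rightarrow> ((nat \<Rightarrow> nat) \<Rightarrow> 'x) \<Rightarrow> real" where
  "poly_sup_norm n N J m a = (SUP w\<in>open_ball_Z n N. norm (hpoly J n m a w))"

end

(* Passing to w |-> P(z_1 w_1, ..., z_n w_n) reduces the claim to the polydisc, with b_alpha = a_alpha z^alpha.
Hoelder's inequality and the weighted AM-GM inequality bound the l_beta norm of x_alpha = ||U b_alpha||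
by the mixed norm (sum_j u_j^t)^(1/t) as soon as sum_alpha (alpha_j/m) x_alpha^s <= u_j^s.  Since
alpha_j b_alpha are the coefficients of E_j = w_j dP/dw_j, s-concavity and a lattice-valued
Khinchine inequality provide u_j = M 2^m avg ||U E_j(w)||, the average being over a finite group
of roots of unity instead of the torus.  The scalar Khinchine inequality comes from ||Q||_4^4 = ||Q^2||_2^2
and the fact that a multi-index of order 2m has at most 4^m smaller ones; by duality it says that
every unit vector of l_2 is the coefficient sequence of a bounded function, which is what lifts it to lattices
without functional calculus.  Finally (t,1)-summability reduces sum_j ||U E_j(w)||^t to
sum_j |phi(E_j(w))|, a directional derivative of phi o P, which Cauchy's estimate controls. *)
theory Submission
  imports Defs "HOL-Complex_Analysis.Cauchy_Integral_Formula"
begin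

subsection \<open>Polynomials on a finite torus\<close>

text \<open>Averaging over L-th roots of unity means that nothing has to be integrated in a lattice;
  with L = 2m + 1 the exponents up to 2m of a squared polynomial stay distinct. The obstacle is that
  a Banach lattice need not be order complete, while the complex modulus and the s-sum are both
  defined as suprema, and s-concavity says something only once its supremum exists. Both are suprema
  of linear combinations with bounded coefficients, so total boundedness of the coefficient set
  yields existence. The assumption s \<ge> 2 makes the conjugate exponent s/(s-1) at most 2: the
  coefficient vectors of the s-sum lie in the unit ball of l_2, where Khinchine applies. The
  operators w_j d/dw_j fit the mixed norm because alpha_j is an integer, so that alpha_j/m \<le>
  alpha_j^s. The final constant collects two factors 2^m, one from Khinchine and one from Cauchy's
  estimate, and a factor c, the product of the concavity and summing constants, which is absorbed
  into (c+1)^m.\<close>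

lemma sum_roots_of_unity_orthogonal:
  assumes "a < L" "b < L"
  shows "(\<Sum>c | c ^ L = 1. c ^ a * cnj c ^ b) = (if a = b then of_nat L else (0::complex))"
proof (cases "a = b")
  case True
  have "c ^ a * cnj c ^ a = 1" if "c ^ L = 1" for c :: complex
  proof -
    have "cmod c = 1" using that assms by (metis power_eq_1_iff less_nat_zero_code)
    then show ?thesis
      by (simp add: complex_norm_square[symmetric] flip: power_mult_distrib)
  qed
  then have "(\<Sum>c | c ^ L = 1. c ^ a * cnj c ^ b) = (\<Sum>c\<in>{c::complex. c ^ L = 1}. 1)"
    using True by (intro sum.cong) auto
  with True assms show ?thesis by (simp add: card_roots_unity_eq)
next
  case False
  define R where "R = {c::complex. c ^ L = 1}"
  define w where "w = cis (2 * pi / real L)"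
  have wL: "w ^ L = 1" using assms unfolding w_def Complex.DeMoivre using assms by simp
  have w0: "w \<noteq> 0" by (simp add: w_def)
  have ne: "w ^ a * cnj w ^ b \<noteq> 1"
  proof
    assume "w ^ a * cnj w ^ b = 1"
    moreover have "cnj w ^ b * w ^ b = 1"
      by (simp add: w_def cis_cnj cis_mult flip: power_mult_distrib)
    ultimately have "w ^ a = w ^ b"
      by (metis mult.assoc mult.commute mult.left_neutral)
    moreover have "w ^ k = exp (2 * of_real pi * \<i> * of_nat k / of_nat L)" for k
      unfolding w_def Complex.DeMoivre by (simp add: cis_conv_exp mult_ac)
    ultimately have "a mod L = b mod L"
      using complex_root_unity_eq[of L a b] assms by (simp add: cong_def)
    with False assms show False by simp
  qed
  \<comment> \<open>Multiplication by the primitive root \<open>w\<close> permutes \<open>R\<close>,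
    so the sum is a fixed point of a multiplication by a factor other than 1.\<close>
  have "(\<Sum>c\<in>R. c ^ a * cnj c ^ b) = (\<Sum>c\<in>R. (w * c) ^ a * cnj (w * c) ^ b)"
    by (rule sum.reindex_bij_witness[where i = "\<lambda>c. w * c" and j = "\<lambda>c. c / w"])
       (auto simp: R_def power_mult_distrib power_divide wL w0)
  also have "\<dots> = w ^ a * cnj w ^ b * (\<Sum>c\<in>R. c ^ a * cnj c ^ b)"
    by (simp add: sum_distrib_left power_mult_distrib mult_ac)
  finally have "(\<Sum>c\<in>R. c ^ a * cnj c ^ b) = 0" using ne by simp
  with False show ?thesis by (simp add: R_def)
qed

text \<open>\<open>PiE\<close> pins the coordinates from n on to \<open>undefined\<close>, which
  keeps the set finite; \<open>monom n\<close> reads only the coordinates below n.\<close>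

definition torus :: "nat \<Rightarrow> nat \<Rightarrow> (nat \<Rightarrow> complex) set" where
  "torus n L = PiE {..<n} (\<lambda>_. {c. c ^ L = 1})"

lemma finite_torus: "L > 0 \<Longrightarrow> finite (torus n L)"
  unfolding torus_def by (intro finite_PiE) (auto intro: finite_roots_unity)

lemma card_torus: "L > 0 \<Longrightarrow> card (torus n L) = L ^ n"
  by (simp add: torus_def card_PiE card_roots_unity_eq)

lemma norm_torus: "g \<in> torus n L \<Longrightarrow> L > 0 \<Longrightarrow> i < n \<Longrightarrow> cmod (g i) = 1"
proof -
  assume "g \<in> torus n L" "L > 0" "i < n"
  then have "g i ^ L = 1" by (auto simp: torus_def)
  then show ?thesis by (metis power_eq_1_iff \<open>L > 0\<close> less_nat_zero_code)
qed

lemma norm_monom_le: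
  assumes "\<And>i. i < n \<Longrightarrow> cmod (z i) \<le> 1"
  shows "cmod (monom n \<alpha> z) \<le> 1"
  unfolding monom_def prod_norm[symmetric] norm_power
  by (intro prod_le_1 conjI power_le_one) (use assms in auto)

lemma monom_add: "monom n (\<lambda>i. \<alpha> i + \<beta> i) z = monom n \<alpha> z * monom n \<beta> z"
  by (simp add: monom_def power_add prod.distrib)

text \<open>On L-th roots of unity exponents matter only modulo L. This is the range in which
  distinct monomials remain distinct, hence orthogonal, characters.\<close>

definition exponents :: "nat \<Rightarrow> nat \<Rightarrow> (nat \<Rightarrow> nat) set" where
  "exponents n L = {\<alpha>. (\<forall>i\<ge>n. \<alpha> i = 0) \<and> (\<forall>i<n. \<alpha> i < L)}"

lemma monom_orthogonal:
  assumes "\<alpha> \<in> exponents n L" "\<beta> \<in> exponents n L" "L > 0"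
  shows "(\<Sum>g\<in>torus n L. monom n \<alpha> g * cnj (monom n \<beta> g)) = (if \<alpha> = \<beta> then of_nat (L ^ n) else 0)"
proof -
  have "(\<Sum>g\<in>torus n L. monom n \<alpha> g * cnj (monom n \<beta> g))
      = (\<Sum>g\<in>torus n L. \<Prod>i<n. g i ^ \<alpha> i * cnj (g i) ^ \<beta> i)"
    by (simp add: monom_def prod.distrib)
  also have "\<dots> = (\<Prod>i<n. \<Sum>c | c ^ L = 1. c ^ \<alpha> i * cnj c ^ \<beta> i)"
    unfolding torus_def using assms by (subst prod_sum_PiE) (auto intro: finite_roots_unity)
  also have "\<dots> = (\<Prod>i<n. if \<alpha> i = \<beta> i then of_nat L else 0)"
    using assms by (intro prod.cong refl sum_roots_of_unity_orthogonal) (auto simp: exponents_def)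
  also have "\<dots> = (if \<alpha> = \<beta> then of_nat (L ^ n) else 0)"
  proof (cases "\<alpha> = \<beta>")
    case False
    then obtain i where "\<alpha> i \<noteq> \<beta> i" by auto
    moreover from this have "i < n"
      using assms(1,2) by (cases "i < n") (simp_all add: exponents_def)
    ultimately show ?thesis using False by auto
  qed simp
  finally show ?thesis .
qed

lemma torus_parseval:
  assumes S: "finite S" "S \<subseteq> exponents n L" "L > 0"
  shows "(\<Sum>g\<in>torus n L. (cmod (\<Sum>\<alpha>\<in>S. c \<alpha> * monom n \<alpha> g))\<^sup>2) = real L ^ n * (\<Sum>\<alpha>\<in>S. (cmod (c \<alpha>))\<^sup>2)"
proof -
  have "complex_of_real (\<Sum>g\<in>torus n L. (cmod (\<Sum>\<alpha>\<in>S. c \<alpha> * monom n \<alpha> g))\<^sup>2)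
      = (\<Sum>g\<in>torus n L. \<Sum>\<alpha>\<in>S. \<Sum>\<beta>\<in>S. c \<alpha> * cnj (c \<beta>) * (monom n \<alpha> g * cnj (monom n \<beta> g)))"
    unfolding of_real_sum complex_norm_square cnj_sum sum_product complex_cnj_mult
    by (intro sum.cong refl) (simp only: mult_ac)
  also have "\<dots> = (\<Sum>\<alpha>\<in>S. \<Sum>\<beta>\<in>S. c \<alpha> * cnj (c \<beta>) * (\<Sum>g\<in>torus n L. monom n \<alpha> g * cnj (monom n \<beta> g)))"
    by (simp add: sum_distrib_left sum.swap[of _ "torus n L"])
  also have "\<dots> = (\<Sum>\<alpha>\<in>S. \<Sum>\<beta>\<in>S. if \<beta> = \<alpha> then c \<alpha> * cnj (c \<beta>) * of_nat (L ^ n) else 0)"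
    using S by (intro sum.cong refl) (subst monom_orthogonal, auto)
  also have "\<dots> = complex_of_real (real L ^ n * (\<Sum>\<alpha>\<in>S. (cmod (c \<alpha>))\<^sup>2))"
    unfolding of_real_mult of_real_sum complex_norm_square using S
    by (simp add: sum_distrib_left mult_ac)
  finally show ?thesis by (simp only: of_real_eq_iff)
qed

lemma multi_index_le: "\<alpha> \<in> multi_indices n m \<Longrightarrow> \<alpha> i \<le> m"
proof -
  assume a: "\<alpha> \<in> multi_indices n m"
  show ?thesis
  proof (cases "i < n")
    case True
    then have "\<alpha> i \<le> (\<Sum>i<n. \<alpha> i)" by (intro member_le_sum) auto
    with a show ?thesis by (simp add: multi_indices_def)
  qed (use a in \<open>auto simp: multi_indices_def\<close>)
qed

lemma multi_index_outside: "\<alpha> \<in> multi_indices n m \<Longrightarrow> \<not> i < n \<Longrightarrow> \<alpha> i = 0"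
  by (simp add: multi_indices_def)

lemma multi_indices_subset_exponents: "m < L \<Longrightarrow> multi_indices n m \<subseteq> exponents n L"
proof
  fix \<alpha> assume "m < L" "\<alpha> \<in> multi_indices n m"
  then show "\<alpha> \<in> exponents n L"
    using multi_index_le[of \<alpha> n m] by (auto simp: exponents_def multi_indices_def intro: le_less_trans)
qed

text \<open>The \<open>if\<close> makes \<alpha> vanish from n on, so restriction to the first n
  coordinates is injective and the set is counted by a box.\<close>

lemma
  fixes n :: nat and b :: "nat \<Rightarrow> nat"
  shows finite_dominated: "finite {\<alpha>. \<forall>i. \<alpha> i \<le> (if i < n then b i else 0::nat)}" (is "finite ?A")
    and card_dominated: "card {\<alpha>. \<forall>i. \<alpha> i \<le> (if i < n then b i else 0::nat)} \<le> (\<Prod>i<n. Suc (b i))"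
proof -
  have inj: "inj_on (\<lambda>\<alpha>. restrict \<alpha> {..<n}) ?A"
  proof (rule inj_onI, rule ext)
    fix \<alpha> \<beta> i
    assume A: "\<alpha> \<in> ?A" "\<beta> \<in> ?A" and eq: "restrict \<alpha> {..<n} = restrict \<beta> {..<n}"
    show "\<alpha> i = \<beta> i"
    proof (cases "i < n")
      case True
      then show ?thesis using fun_cong[OF eq, of i] by simp
    next
      case False
      have "\<alpha> i \<le> (if i < n then b i else 0)" "\<beta> i \<le> (if i < n then b i else 0)" using A by blast+
      with False show ?thesis by simp
    qed
  qed
  have img: "(\<lambda>\<alpha>. restrict \<alpha> {..<n}) ` ?A \<subseteq> PiE {..<n} (\<lambda>i. {..b i})"
  proof clarify
    fix \<alpha> assume A: "\<forall>i. \<alpha> i \<le> (if i < n then b i else 0)"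
    have "\<alpha> i \<le> b i" if "i < n" for i using spec[OF A, of i] that by simp
    then show "restrict \<alpha> {..<n} \<in> PiE {..<n} (\<lambda>i. {..b i})" by auto
  qed
  have fin: "finite (PiE {..<n} (\<lambda>i. {..b i}))" by (intro finite_PiE) auto
  show "finite ?A" using inj_on_finite[OF inj img fin] .
  show "card ?A \<le> (\<Prod>i<n. Suc (b i))"
    using card_inj_on_le[OF inj img fin] by (simp add: card_PiE)
qed

lemma finite_multi_indices: "finite (multi_indices n m)"
  by (rule finite_subset[OF _ finite_dominated[of n "\<lambda>_. m"]])
     (auto simp: multi_index_le intro: multi_index_outside)

text \<open>The square has degree 2m, and \<open>2 * m < L\<close> keeps its monomials orthogonal.
  Its coefficient at \<gamma> sums over the splittings \<gamma> = \<alpha> + \<beta>, and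
  Cauchy-Schwarz costs the number of these splittings, each of which is determined by
  \<alpha>.\<close>

lemma torus_L4_bound:
  fixes c :: "(nat \<Rightarrow> nat) \<Rightarrow> complex"
  assumes L: "2 * m < L"
  shows "(\<Sum>g\<in>torus n L. (cmod (\<Sum>\<alpha>\<in>multi_indices n m. c \<alpha> * monom n \<alpha> g)) ^ 4)
       \<le> real L ^ n * 4 ^ m * (\<Sum>\<alpha>\<in>multi_indices n m. (cmod (c \<alpha>))\<^sup>2)\<^sup>2"
proof -
  let ?S = "multi_indices n m" and ?S2 = "multi_indices n (2 * m)"
  define pl where "pl = (\<lambda>(\<alpha>,\<beta>) (i::nat). \<alpha> i + \<beta> i :: nat)"
  define F where "F \<gamma> = {p \<in> ?S \<times> ?S. pl p = \<gamma>}" for \<gamma>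
  define d where "d \<gamma> = (\<Sum>(\<alpha>,\<beta>)\<in>F \<gamma>. c \<alpha> * c \<beta>)" for \<gamma>
  note fin = finite_multi_indices
  have finF: "finite (F \<gamma>)" for \<gamma> by (simp add: F_def fin)
  have plS: "pl ` (?S \<times> ?S) \<subseteq> ?S2"
    by (auto simp: pl_def multi_indices_def sum.distrib)
  have sq: "(\<Sum>\<alpha>\<in>?S. c \<alpha> * monom n \<alpha> g)\<^sup>2 = (\<Sum>\<gamma>\<in>?S2. d \<gamma> * monom n \<gamma> g)" for g
  proof -
    have "(\<Sum>\<alpha>\<in>?S. c \<alpha> * monom n \<alpha> g)\<^sup>2
        = (\<Sum>p\<in>?S \<times> ?S. c (fst p) * c (snd p) * monom n (pl p) g)"
      by (simp add: power2_eq_square sum_product sum.cartesian_product pl_def monom_add case_prod_beta mult_ac)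
    also have "\<dots> = (\<Sum>\<gamma>\<in>?S2. \<Sum>p\<in>F \<gamma>. c (fst p) * c (snd p) * monom n (pl p) g)"
      unfolding F_def using fin plS by (intro sum.group[symmetric]) auto
    also have "\<dots> = (\<Sum>\<gamma>\<in>?S2. d \<gamma> * monom n \<gamma> g)"
      by (auto simp: d_def sum_distrib_right case_prod_beta F_def intro!: sum.cong)
    finally show ?thesis .
  qed
  have cardF: "card (F \<gamma>) \<le> 4 ^ m" if \<gamma>: "\<gamma> \<in> ?S2" for \<gamma>
  proof -
    let ?B = "{\<alpha>. \<forall>i. \<alpha> i \<le> (if i < n then \<gamma> i else 0)}"
    have "inj_on fst (F \<gamma>)"
      by (rule inj_onI) (auto simp: F_def pl_def fun_eq_iff, metis add_left_cancel)
    moreover have "fst ` F \<gamma> \<subseteq> ?B"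
      by (auto simp: F_def pl_def multi_indices_def)
    ultimately have "card (F \<gamma>) \<le> card ?B"
      using finite_dominated by (rule card_inj_on_le)
    also have "\<dots> \<le> (\<Prod>i<n. Suc (\<gamma> i))" by (rule card_dominated)
    \<comment> \<open>Uses 1 + k \<le> 2^k in each coordinate; the total degree 2m then removes any
      dependence on n.\<close>
    also have "\<dots> \<le> (\<Prod>i<n. 2 ^ \<gamma> i)" by (intro prod_mono) (auto simp: Suc_le_eq)
    also have "\<dots> = 2 ^ (\<Sum>i<n. \<gamma> i)" by (simp add: power_sum)
    also have "\<dots> = 4 ^ m" using \<gamma> by (simp add: multi_indices_def power_mult)
    finally show ?thesis .
  qed
  have dbound: "(cmod (d \<gamma>))\<^sup>2 \<le> 4 ^ m * (\<Sum>p\<in>F \<gamma>. (cmod (c (fst p)))\<^sup>2 * (cmod (c (snd p)))\<^sup>2)"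
    if \<gamma>: "\<gamma> \<in> ?S2" for \<gamma>
  proof -
    have "cmod (d \<gamma>) \<le> (\<Sum>p\<in>F \<gamma>. 1 * (cmod (c (fst p)) * cmod (c (snd p))))"
      unfolding d_def by (intro sum_norm_le) (auto simp: norm_mult)
    then have "(cmod (d \<gamma>))\<^sup>2 \<le> (\<Sum>p\<in>F \<gamma>. 1 * (cmod (c (fst p)) * cmod (c (snd p))))\<^sup>2"
      by (intro power_mono) auto
    also have "\<dots> \<le> (\<Sum>p\<in>F \<gamma>. 1\<^sup>2) * (\<Sum>p\<in>F \<gamma>. (cmod (c (fst p)) * cmod (c (snd p)))\<^sup>2)"
      by (rule Cauchy_Schwarz_ineq_sum)
    also have "\<dots> \<le> 4 ^ m * (\<Sum>p\<in>F \<gamma>. (cmod (c (fst p)))\<^sup>2 * (cmod (c (snd p)))\<^sup>2)"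
    proof -
      have "real (card (F \<gamma>)) \<le> 4 ^ m"
        using cardF[OF \<gamma>] by (metis of_nat_le_iff of_nat_numeral of_nat_power)
      then show ?thesis
        by (simp add: power_mult_distrib) (intro mult_right_mono sum_nonneg, auto)
    qed
    finally show ?thesis .
  qed
  have "(\<Sum>g\<in>torus n L. (cmod (\<Sum>\<alpha>\<in>?S. c \<alpha> * monom n \<alpha> g)) ^ 4)
      = (\<Sum>g\<in>torus n L. (cmod (\<Sum>\<gamma>\<in>?S2. d \<gamma> * monom n \<gamma> g))\<^sup>2)"
    by (simp add: sq[symmetric] norm_power flip: power_mult)
  also have "\<dots> = real L ^ n * (\<Sum>\<gamma>\<in>?S2. (cmod (d \<gamma>))\<^sup>2)"
    using L fin multi_indices_subset_exponents by (intro torus_parseval) auto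
  also have "\<dots> \<le> real L ^ n * (\<Sum>\<gamma>\<in>?S2. 4 ^ m * (\<Sum>p\<in>F \<gamma>. (cmod (c (fst p)))\<^sup>2 * (cmod (c (snd p)))\<^sup>2))"
    by (intro mult_left_mono sum_mono dbound) auto
  also have "\<dots> = real L ^ n * 4 ^ m * (\<Sum>p\<in>?S \<times> ?S. (cmod (c (fst p)))\<^sup>2 * (cmod (c (snd p)))\<^sup>2)"
    unfolding F_def using fin plS by (subst sum.group[symmetric, of _ ?S2 pl]) (auto simp: sum_distrib_left mult_ac)
  also have "\<dots> = real L ^ n * 4 ^ m * (\<Sum>\<alpha>\<in>?S. (cmod (c \<alpha>))\<^sup>2)\<^sup>2"
    by (simp add: power2_eq_square sum_product sum.cartesian_product case_prod_beta)
  finally show ?thesis .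
qed

text \<open>Interpolation of L2 between L1 and L4, which turns an upper bound on the fourth moment
  into a lower bound on the first. Two Cauchy-Schwarz inequalities, between moments 1, 2, 3 and
  between 2, 3, 4, eliminate the third moment.\<close>

lemma sum_L1_L2_L4:
  fixes f :: "'a \<Rightarrow> real"
  assumes "\<And>x. x \<in> A \<Longrightarrow> f x \<ge> 0"
  shows "(\<Sum>x\<in>A. (f x)\<^sup>2) ^ 3 \<le> (\<Sum>x\<in>A. f x)\<^sup>2 * (\<Sum>x\<in>A. f x ^ 4)"
proof -
  let ?M = "\<lambda>k. \<Sum>x\<in>A. f x ^ k"
  have nn: "?M k \<ge> 0" for k by (intro sum_nonneg zero_le_power assms)
  have "(\<Sum>x\<in>A. sqrt (f x) * (sqrt (f x) * f x))\<^sup>2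
      \<le> (\<Sum>x\<in>A. (sqrt (f x))\<^sup>2) * (\<Sum>x\<in>A. (sqrt (f x) * f x)\<^sup>2)"
    by (rule Cauchy_Schwarz_ineq_sum)
  moreover have "(\<Sum>x\<in>A. sqrt (f x) * (sqrt (f x) * f x)) = ?M 2"
    using assms by (intro sum.cong) (auto simp: power2_eq_square simp flip: mult.assoc)
  moreover have "(\<Sum>x\<in>A. (sqrt (f x) * f x)\<^sup>2) = ?M 3"
    using assms by (intro sum.cong) (auto simp: power2_eq_square power3_eq_cube power_mult_distrib)
  ultimately have a: "(?M 2)\<^sup>2 \<le> ?M 1 * ?M 3" using assms by simp
  have b: "(?M 3)\<^sup>2 \<le> ?M 2 * ?M 4"
    using Cauchy_Schwarz_ineq_sum[of f "\<lambda>x. (f x)\<^sup>2" A]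
    by (simp add: eval_nat_numeral mult_ac)
  have "(?M 2) ^ 4 = ((?M 2)\<^sup>2)\<^sup>2" by (simp flip: power_mult)
  also have "\<dots> \<le> (?M 1 * ?M 3)\<^sup>2" using a by (intro power_mono) auto
  also have "\<dots> \<le> (?M 1)\<^sup>2 * (?M 2 * ?M 4)"
    using b by (simp add: power_mult_distrib mult_left_mono)
  finally have "?M 2 * (?M 2) ^ 3 \<le> ?M 2 * ((?M 1)\<^sup>2 * ?M 4)" by (simp add: eval_nat_numeral mult_ac)
  then show ?thesis
    using nn[of 2] nn[of 4] by (cases "?M 2 = 0") (auto simp: mult_le_cancel_left)
qed

text \<open>The fourth moment bound is inserted into the interpolation inequality; 2^m is the square
  root of the number 4^m of splittings, and 1/L^n normalises the sum to a mean.\<close>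

lemma torus_khinchine:
  assumes L: "2 * m < L"
  shows "sqrt (\<Sum>\<alpha>\<in>multi_indices n m. (cmod (c \<alpha>))\<^sup>2)
    \<le> 2 ^ m / real L ^ n * (\<Sum>g\<in>torus n L. cmod (\<Sum>\<alpha>\<in>multi_indices n m. c \<alpha> * monom n \<alpha> g))"
proof -
  let ?S = "\<Sum>\<alpha>\<in>multi_indices n m. (cmod (c \<alpha>))\<^sup>2"
  let ?f = "\<lambda>g. cmod (\<Sum>\<alpha>\<in>multi_indices n m. c \<alpha> * monom n \<alpha> g)"
  let ?I = "\<Sum>g\<in>torus n L. ?f g"
  have I0: "?I \<ge> 0" by (intro sum_nonneg) auto
  show ?thesis
  proof (cases "?S = 0")
    case False
    then have S: "?S > 0" by (simp add: less_le sum_nonneg)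
    have T: "real L ^ n > 0" using L by simp
    have "(real L ^ n * ?S) ^ 3 = (\<Sum>g\<in>torus n L. (?f g)\<^sup>2) ^ 3"
      using L finite_multi_indices multi_indices_subset_exponents by (subst torus_parseval) auto
    also have "\<dots> \<le> ?I\<^sup>2 * (\<Sum>g\<in>torus n L. ?f g ^ 4)"
      by (rule sum_L1_L2_L4) auto
    also have "\<dots> \<le> ?I\<^sup>2 * (real L ^ n * 4 ^ m * ?S\<^sup>2)"
      by (intro mult_left_mono torus_L4_bound L) auto
    finally have "(real L ^ n * ?S\<^sup>2) * ((real L ^ n)\<^sup>2 * ?S) \<le> (real L ^ n * ?S\<^sup>2) * (4 ^ m * ?I\<^sup>2)"
      by (simp add: power_mult_distrib eval_nat_numeral mult_ac)
    then have "(real L ^ n)\<^sup>2 * ?S \<le> 4 ^ m * ?I\<^sup>2"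
      using S T by (subst (asm) mult_le_cancel_left_pos) auto
    also have "\<dots> = (2 ^ m * ?I)\<^sup>2"
      by (simp add: power_mult_distrib power_even_eq[symmetric] power_mult)
    finally have "sqrt ((real L ^ n)\<^sup>2 * ?S) \<le> sqrt ((2 ^ m * ?I)\<^sup>2)"
      by (rule real_sqrt_le_mono)
    then have "real L ^ n * sqrt ?S \<le> 2 ^ m * ?I"
      using I0 by (simp add: real_sqrt_mult)
    then show ?thesis using T by (simp add: field_simps)
  qed (use I0 in simp)
qed

section \<open>Duality: square-summable coefficients from bounded functions\<close>

lemma compact_unit_functions: "compact {h :: 'g \<Rightarrow> complex. \<forall>g. cmod (h g) \<le> 1}"
proof -
  have "compactin (product_topology (\<lambda>_::'g. euclidean :: complex topology) UNIV) (PiE UNIV (\<lambda>_. cball 0 1))"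
    by (auto simp: compactin_PiE)
  then have "compactin (euclidean :: ('g \<Rightarrow> complex) topology) (PiE UNIV (\<lambda>_. cball 0 1))"
    by (simp add: euclidean_product_topology)
  moreover have "PiE UNIV (\<lambda>_. cball 0 1) = {h :: 'g \<Rightarrow> complex. \<forall>g. cmod (h g) \<le> 1}"
    by (auto simp: PiE_def Pi_def)
  ultimately show ?thesis by simp
qed

text \<open>\<open>L1L2\<close> bounds the map from c to \<Sum> c \<alpha> e \<alpha> from below,
  from l_2 into l_1(G); hence its transpose, scaled by K, maps the unit ball of l_infinity over a
  set containing the unit ball of l_2. Instead of a separation theorem, the point nearest to
  \<open>d\<close> in the compact convex image is taken, and the residual is shown to
  vanish.\<close>

lemma bounded_interpolation:
  fixes e :: "'i \<Rightarrow> 'g \<Rightarrow> complex" and d :: "'i \<Rightarrow> complex"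
  assumes A: "finite A" and G: "finite G" and K: "K \<ge> 0"
    and L1L2: "\<And>c. sqrt (\<Sum>\<alpha>\<in>A. (cmod (c \<alpha>))\<^sup>2) \<le> K * (\<Sum>g\<in>G. cmod (\<Sum>\<alpha>\<in>A. c \<alpha> * e \<alpha> g))"
    and d: "(\<Sum>\<alpha>\<in>A. (cmod (d \<alpha>))\<^sup>2) \<le> 1"
  obtains h where "\<And>g. cmod (h g) \<le> 1" "\<And>\<alpha>. \<alpha> \<in> A \<Longrightarrow> d \<alpha> = K * (\<Sum>g\<in>G. h g * e \<alpha> g)"
proof -
  define B where "B = {h :: 'g \<Rightarrow> complex. \<forall>g. cmod (h g) \<le> 1}"
  define T where "T h \<alpha> = K * (\<Sum>g\<in>G. h g * e \<alpha> g)" for h \<alpha>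
  define F where "F h = (\<Sum>\<alpha>\<in>A. (cmod (d \<alpha> - T h \<alpha>))\<^sup>2)" for h
  have cont: "continuous_on B F"
    unfolding F_def T_def by (intro continuous_intros continuous_on_subset[OF continuous_on_product_coordinates]) auto
  have "B \<noteq> {}" by (auto simp: B_def intro!: exI[of _ "\<lambda>_. 0"])
  then obtain h where hB: "h \<in> B" and hmin: "\<And>h'. h' \<in> B \<Longrightarrow> F h \<le> F h'"
    using continuous_attains_inf[OF _ _ cont] compact_unit_functions unfolding B_def by blast
  define r where "r \<alpha> = d \<alpha> - T h \<alpha>" for \<alpha>
  \<comment> \<open>First-order condition at a nearest point of a convex set: the residual makes no
    acute angle with a direction into the set. It comes from comparing \<open>h\<close> with the
    segment towards \<open>h'\<close>.\<close>
  have variation: "Re (\<Sum>\<alpha>\<in>A. cnj (r \<alpha>) * (T h' \<alpha> - T h \<alpha>)) \<le> 0" if h': "h' \<in> B" for h'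
  proof -
    define D where "D \<alpha> = T h' \<alpha> - T h \<alpha>" for \<alpha>
    define p where "p = Re (\<Sum>\<alpha>\<in>A. cnj (r \<alpha>) * D \<alpha>)"
    define q where "q = (\<Sum>\<alpha>\<in>A. (cmod (D \<alpha>))\<^sup>2)"
    have q0: "q \<ge> 0" unfolding q_def by (intro sum_nonneg) auto
    have quad: "2 * p \<le> \<tau> * q" if \<tau>: "0 < \<tau>" "\<tau> \<le> 1" for \<tau> :: real
    proof -
      let ?k = "\<lambda>g. (1 - of_real \<tau>) * h g + of_real \<tau> * h' g"
      have "?k \<in> B"
        unfolding B_def
      proof safe
        fix g
        have "cmod (?k g) \<le> (1 - \<tau>) * cmod (h g) + \<tau> * cmod (h' g)"
          using \<tau> norm_triangle_ineq[of "(1 - of_real \<tau>) * h g" "of_real \<tau> * h' g"]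
          by (simp add: norm_mult) (metis abs_of_nonneg diff_ge_0_iff_ge norm_of_real of_real_1 of_real_diff)
        also have "\<dots> \<le> (1 - \<tau>) * 1 + \<tau> * 1"
          using hB h' \<tau> by (intro add_mono mult_left_mono) (auto simp: B_def)
        finally show "cmod (?k g) \<le> 1" by simp
      qed
      have Tk: "d \<alpha> - T ?k \<alpha> = r \<alpha> - of_real \<tau> * D \<alpha>" for \<alpha>
        by (simp add: r_def D_def T_def algebra_simps sum.distrib sum_subtractf sum_distrib_left)
      have "(cmod (r \<alpha> - of_real \<tau> * D \<alpha>))\<^sup>2
          = (cmod (r \<alpha>))\<^sup>2 - 2 * \<tau> * Re (cnj (r \<alpha>) * D \<alpha>) + \<tau>\<^sup>2 * (cmod (D \<alpha>))\<^sup>2" for \<alpha>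
        unfolding cmod_power2 by (simp add: power2_eq_square algebra_simps)
      then have "F ?k = F h - 2 * \<tau> * p + \<tau>\<^sup>2 * q"
        unfolding F_def Tk p_def q_def r_def[symmetric]
        by (simp add: sum.distrib sum_subtractf sum_distrib_left distrib_left mult_ac del: times_complex.sel)
      with hmin[OF \<open>?k \<in> B\<close>] have "\<tau> * (2 * p) \<le> \<tau> * (\<tau> * q)" by (simp add: power2_eq_square)
      with \<tau> show ?thesis by simp
    qed
    have "p \<le> 0"
    proof (rule ccontr)
      assume "\<not> p \<le> 0"
      then have p: "p > 0" by simp
      \<comment> \<open>Small enough that the quadratic term \<tau> q stays below the linear term 2
        p; the 1 in q + 1 covers q = 0.\<close>
      define \<tau> where "\<tau> = min 1 (p / (q + 1))"
      have \<tau>: "0 < \<tau>" "\<tau> \<le> 1" using p q0 by (auto simp: \<tau>_def)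
      have "2 * p \<le> \<tau> * q" using quad[OF \<tau>] .
      also have "\<dots> \<le> p / (q + 1) * q" using q0 by (intro mult_right_mono) (auto simp: \<tau>_def)
      also have "\<dots> \<le> p" using p q0 by (simp add: field_simps)
      finally show False using p by simp
    qed
    then show ?thesis by (simp add: p_def D_def)
  qed
  define R where "R g = (\<Sum>\<alpha>\<in>A. cnj (r \<alpha>) * e \<alpha> g)" for g
  define \<rho> where "\<rho> = sqrt (\<Sum>\<alpha>\<in>A. (cmod (r \<alpha>))\<^sup>2)"
  have \<rho>0: "\<rho> \<ge> 0" by (simp add: \<rho>_def sum_nonneg)
  have \<rho>2: "\<rho>\<^sup>2 = (\<Sum>\<alpha>\<in>A. (cmod (r \<alpha>))\<^sup>2)" by (simp add: \<rho>_def sum_nonneg)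
  \<comment> \<open>The competitor that attains the l_1 norm of \<open>R\<close>; where
    \<open>R g\<close> is 0 it takes the value 0, which is still admissible.\<close>
  define h' where "h' g = cnj (sgn (R g))" for g
  have h'B: "h' \<in> B" by (auto simp: B_def h'_def norm_sgn)
  have h'R: "h' g * R g = of_real (cmod (R g))" for g
    using complex_norm_square[of "R g"]
    by (cases "R g = 0") (auto simp: h'_def sgn_eq power2_eq_square mult.commute nonzero_divide_eq_eq)
  \<comment> \<open>The chain starting here ends in \<rho> - \<rho>^2, because T h = d - r and
    \<open>d\<close> has l_2 norm at most 1; this forces \<rho> = 0.\<close>
  have "\<rho> \<le> K * (\<Sum>g\<in>G. cmod (R g))"
    using L1L2[of "\<lambda>\<alpha>. cnj (r \<alpha>)"] by (simp add: \<rho>_def R_def)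
  also have "complex_of_real (K * (\<Sum>g\<in>G. cmod (R g))) = (\<Sum>\<alpha>\<in>A. cnj (r \<alpha>) * T h' \<alpha>)"
  proof -
    have "(\<Sum>\<alpha>\<in>A. cnj (r \<alpha>) * T h' \<alpha>) = K * (\<Sum>g\<in>G. h' g * R g)"
      unfolding T_def R_def sum_distrib_left
      by (subst sum.swap) (simp add: mult_ac)
    then show ?thesis by (simp add: h'R)
  qed
  then have "K * (\<Sum>g\<in>G. cmod (R g)) = Re (\<Sum>\<alpha>\<in>A. cnj (r \<alpha>) * T h' \<alpha>)"
    by (metis Re_complex_of_real)
  also have "\<dots> \<le> Re (\<Sum>\<alpha>\<in>A. cnj (r \<alpha>) * T h \<alpha>)"
    using variation[OF h'B] by (simp add: algebra_simps sum_subtractf)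
  also have "\<dots> = (\<Sum>\<alpha>\<in>A. Re (cnj (r \<alpha>) * d \<alpha>)) - \<rho>\<^sup>2"
    unfolding \<rho>2 Re_sum sum_subtractf[symmetric]
    unfolding r_def cmod_power2
    by (intro sum.cong refl) (simp add: power2_eq_square algebra_simps)
  also have "(\<Sum>\<alpha>\<in>A. Re (cnj (r \<alpha>) * d \<alpha>)) \<le> (\<Sum>\<alpha>\<in>A. cmod (r \<alpha>) * cmod (d \<alpha>))"
    by (intro sum_mono) (metis complex_Re_le_cmod complex_mod_cnj norm_mult)
  also have "\<dots> \<le> \<rho>"
  proof (rule power2_le_imp_le[OF _ \<rho>0])
    have "(\<Sum>\<alpha>\<in>A. cmod (r \<alpha>) * cmod (d \<alpha>))\<^sup>2 \<le> \<rho>\<^sup>2 * (\<Sum>\<alpha>\<in>A. (cmod (d \<alpha>))\<^sup>2)"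
      unfolding \<rho>2 by (rule Cauchy_Schwarz_ineq_sum)
    also have "\<dots> \<le> \<rho>\<^sup>2 * 1" using d by (intro mult_left_mono) auto
    finally show "(\<Sum>\<alpha>\<in>A. cmod (r \<alpha>) * cmod (d \<alpha>))\<^sup>2 \<le> \<rho>\<^sup>2" by simp
  qed
  finally have "\<rho>\<^sup>2 \<le> 0" by simp
  then have "(\<Sum>\<alpha>\<in>A. (cmod (r \<alpha>))\<^sup>2) = 0"
    using \<rho>2 zero_le_power2[of \<rho>] by linarith
  then have "r \<alpha> = 0" if "\<alpha> \<in> A" for \<alpha>
    using A that by (auto simp: sum_nonneg_eq_0_iff)
  with hB show ?thesis
    by (intro that[of h]) (auto simp: B_def r_def T_def)
qed

subsection \<open>Suprema and moduli in Banach lattices\<close>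

lemma is_lub_unique: "is_lub A x \<Longrightarrow> is_lub A y \<Longrightarrow> x = y"
  by (auto simp: is_lub_def intro!: antisym)

lemma is_lub_scaleR:
  fixes z :: "'r::ordered_real_vector"
  assumes "is_lub (range f) z" "r \<ge> 0"
  shows "is_lub (range (\<lambda>x. r *\<^sub>R f x)) (r *\<^sub>R z)"
proof (cases "r = 0")
  case False
  with assms have r: "r > 0" by simp
  have "r *\<^sub>R z \<le> u" if u: "\<And>x. r *\<^sub>R f x \<le> u" for u
  proof -
    have "f x \<le> (1 / r) *\<^sub>R u" for x
      using scaleR_left_mono[OF u[of x], of "1 / r"] r by simp
    then have "z \<le> (1 / r) *\<^sub>R u" using assms(1) by (auto simp: is_lub_def)
    then show ?thesis using scaleR_left_mono[of z "(1 / r) *\<^sub>R u" r] r by simp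
  qed
  then show ?thesis using assms by (auto simp: is_lub_def scaleR_left_mono)
qed (auto simp: is_lub_def)

text \<open>Translations preserve order, so one summand at a time can be isolated and replaced by
  its supremum. The choices \<theta> k are independent, and this allows sums of moduli to be
  estimated through rotated real parts with arbitrary angles.\<close>

lemma sum_lub_le:
  fixes l :: "'a \<Rightarrow> 'r::ordered_real_vector"
  assumes "finite A" "\<And>k. k \<in> A \<Longrightarrow> is_lub (range (h k)) (l k)"
    and "\<And>\<theta>. (\<Sum>k\<in>A. h k (\<theta> k)) \<le> V"
  shows "sum l A \<le> V"
  using assms
proof (induction A arbitrary: V rule: finite_induct)
  case (insert a A)
  have "sum l A \<le> V - h a x" for x
  proof (rule insert.IH)
    fix \<theta>
    have "(\<Sum>k\<in>A. h k ((\<theta>(a := x)) k)) = (\<Sum>k\<in>A. h k (\<theta> k))"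
      using insert.hyps by (intro sum.cong) auto
    then show "(\<Sum>k\<in>A. h k (\<theta> k)) \<le> V - h a x"
      using insert.prems(2)[of "\<theta>(a := x)"] insert.hyps by (simp add: algebra_simps)
  qed (use insert.prems in auto)
  then have "h a x \<le> V - sum l A" for x by (simp add: algebra_simps)
  then have "l a \<le> V - sum l A"
    using insert.prems(1)[of a] by (auto simp: is_lub_def)
  then show ?case using insert.hyps by (simp add: algebra_simps)
qed simp

lemma ordered_half_nonneg:
  fixes x :: "'r::ordered_real_vector"
  assumes "0 \<le> x + x"
  shows "0 \<le> x"
proof -
  have "(1/2::real) *\<^sub>R (x + x) = x" by (simp add: scaleR_2[symmetric])
  with scaleR_left_mono[OF assms, of "1/2"] show ?thesis by simp
qed

lemma lat_abs_nonneg: "0 \<le> lat_abs (x :: 'r::{ordered_real_vector, lattice})"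
proof -
  have "x + (- x) \<le> lat_abs x + lat_abs x" unfolding lat_abs_def by (intro add_mono) auto
  then show ?thesis by (intro ordered_half_nonneg[of "lat_abs x"]) (simp only: add.right_inverse)
qed

lemma lat_abs_of_nonneg: "0 \<le> x \<Longrightarrow> lat_abs (x :: 'r::{ordered_real_vector, lattice}) = x"
  unfolding lat_abs_def by (rule sup_absorb1) (use order_trans[of "- x" 0 x] in simp)

context
  assumes lat: "banach_lattice TYPE('r::{banach, ordered_real_vector, lattice})"
begin

lemma norm_mono_nonneg: "0 \<le> x \<Longrightarrow> x \<le> y \<Longrightarrow> norm (x :: 'r) \<le> norm y"
  using lat by (simp add: banach_lattice_def lat_abs_of_nonneg)

lemma norm_le_if_between:
  assumes "- y \<le> x" "x \<le> (y :: 'r)"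
  shows "norm x \<le> norm y"
proof -
  have "- x \<le> y" using assms(1) by (simp add: minus_le_iff)
  then have "lat_abs x \<le> y" using assms by (simp add: lat_abs_def)
  then have "lat_abs x \<le> lat_abs y" by (simp add: lat_abs_def le_supI1)
  then show ?thesis using lat by (simp add: banach_lattice_def)
qed

lemma norm_lat_abs: "norm (lat_abs (x :: 'r)) = norm x"
proof -
  have "lat_abs (lat_abs x) = lat_abs x" by (simp add: lat_abs_of_nonneg lat_abs_nonneg)
  then show ?thesis using lat unfolding banach_lattice_def by (metis antisym order_refl)
qed

text \<open>The negative part of the limit lies below |u n - x|, so its norm tends to 0.\<close>

lemma cone_closed:
  fixes u :: "nat \<Rightarrow> 'r"
  assumes u: "\<And>n. 0 \<le> u n" and lim: "u \<longlonglongrightarrow> x"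
  shows "0 \<le> x"
proof -
  have "norm (sup (- x) 0) \<le> norm (u n - x)" for n
  proof -
    have "- x \<le> u n - x" using u[of n] by simp
    also have "\<dots> \<le> lat_abs (u n - x)" by (simp add: lat_abs_def)
    finally have "sup (- x) 0 \<le> lat_abs (u n - x)" by (simp add: lat_abs_nonneg)
    then have "norm (sup (- x) 0) \<le> norm (lat_abs (u n - x))" by (intro norm_mono_nonneg) auto
    then show ?thesis by (simp add: norm_lat_abs)
  qed
  moreover have "(\<lambda>n. norm (u n - x)) \<longlonglongrightarrow> 0"
    using lim by (simp add: LIM_zero_iff tendsto_norm_zero)
  ultimately have "norm (sup (- x) 0) \<le> 0"
    by (intro LIMSEQ_le_const) auto
  then have "sup (- x) 0 = 0" by simp
  then show ?thesis by (metis neg_le_0_iff_le sup_ge1)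
qed

lemma lattice_limit_le:
  fixes u v :: "nat \<Rightarrow> 'r"
  assumes "\<And>n. u n \<le> v n" "u \<longlonglongrightarrow> x" "v \<longlonglongrightarrow> y"
  shows "x \<le> y"
  using cone_closed[of "\<lambda>n. v n - u n" "y - x"] assms by (simp add: tendsto_diff)

text \<open>A bounded subset of a Banach lattice need not have a supremum, but finite nets suffice
when they approximate from below relative to one fixed element \<open>e\<close>.\<close>

lemma ex_lub_if_finite_nets:
  fixes S :: "'r set" and e :: 'r
  assumes e: "0 \<le> e"
    and nets: "\<And>k::nat. \<exists>F. finite F \<and> F \<noteq> {} \<and> F \<subseteq> S \<and> (\<forall>p\<in>S. \<exists>q\<in>F. p \<le> q + (1 / real (Suc k)) *\<^sub>R e)"
  shows "\<exists>z. is_lub S z"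
proof -
  obtain F where F: "\<And>k. finite (F k)" "\<And>k. F k \<noteq> {}" "\<And>k. F k \<subseteq> S"
    and net: "\<And>k p. p \<in> S \<Longrightarrow> \<exists>q\<in>F k. p \<le> q + (1 / real (Suc k)) *\<^sub>R e"
    using nets by metis
  define z where "z k = Sup_fin (F k)" for k
  have below: "p \<le> z k + (1 / real (Suc k)) *\<^sub>R e" if p: "p \<in> S" for p k
  proof -
    obtain q where q: "q \<in> F k" "p \<le> q + (1 / real (Suc k)) *\<^sub>R e" using net[OF p] by blast
    have "q \<le> z k" unfolding z_def using F q by (intro Sup_fin.coboundedI)
    with q(2) show ?thesis by (meson add_right_mono order_trans)
  qed
  \<comment> \<open>Each net consists of elements of \<open>S\<close> and is therefore controlled by
    every other net. Exchanging k and l bounds z k - z l on both sides, which makes z a Cauchy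
    sequence.\<close>
  have step: "z l \<le> z k + (1 / real (Suc k)) *\<^sub>R e" for k l
    unfolding z_def[of l] using F below by (intro Sup_fin.boundedI) blast+
  have dist: "norm (z k - z l) \<le> (1 / real (Suc k) + 1 / real (Suc l)) * norm e" for k l
  proof -
    let ?d = "(1 / real (Suc k) + 1 / real (Suc l)) *\<^sub>R e"
    have "(1 / real (Suc k)) *\<^sub>R e \<le> ?d" "(1 / real (Suc l)) *\<^sub>R e \<le> ?d"
      using e by (auto intro!: scaleR_right_mono)
    then have "z l \<le> z k + ?d" "z k \<le> z l + ?d"
      using step[of l k] step[of k l] by (meson add_left_mono order_trans)+
    then have "norm (z k - z l) \<le> norm ?d"
      by (intro norm_le_if_between) (simp_all add: algebra_simps)
    then show ?thesis by simp
  qed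
  have "Cauchy z"
  proof (rule CauchyI)
    fix \<epsilon> :: real assume \<epsilon>: "0 < \<epsilon>"
    obtain M where M: "2 * norm e / \<epsilon> < real M" using reals_Archimedean2 by blast
    then have M0: "M > 0" using \<epsilon> by (intro gr0I) (auto simp: divide_less_0_iff)
    have "norm (z k - z l) < \<epsilon>" if "k \<ge> M" "l \<ge> M" for k l
    proof -
      have "1 / real (Suc k) \<le> 1 / real M" "1 / real (Suc l) \<le> 1 / real M"
        using that M0 by (auto intro!: divide_left_mono)
      then have "(1 / real (Suc k) + 1 / real (Suc l)) * norm e \<le> (2 / real M) * norm e"
        by (intro mult_right_mono) auto
      also have "\<dots> < \<epsilon>" using M M0 \<epsilon> by (simp add: field_simps)
      finally show ?thesis using dist[of k l] by linarith
    qed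
    then show "\<exists>M. \<forall>m\<ge>M. \<forall>n\<ge>M. norm (z m - z n) < \<epsilon>" by blast
  qed
  then obtain x where x: "z \<longlonglongrightarrow> x" using Cauchy_convergent convergent_def by blast
  have lim: "(\<lambda>k. z k + (1 / real (Suc k)) *\<^sub>R e) \<longlonglongrightarrow> x + 0 *\<^sub>R e"
    by (intro tendsto_intros x) (rule LIMSEQ_inverse_real_of_nat[unfolded inverse_eq_divide])
  have "p \<le> x" if "p \<in> S" for p
    using lattice_limit_le[OF below[OF that] tendsto_const lim] by simp
  moreover have "x \<le> u" if "\<And>p. p \<in> S \<Longrightarrow> p \<le> u" for u
  proof (rule lattice_limit_le[OF _ x tendsto_const])
    show "z k \<le> u" for k
      unfolding z_def using F that by (intro Sup_fin.boundedI) blast+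
  qed
  ultimately show ?thesis unfolding is_lub_def by (intro exI[of _ x]) blast
qed

text \<open>The coefficient vectors lie in the cube [-1,1]^N. Changing each coefficient by at most
  1/K raises the combination by at most 1/K times \<Sum> |y k|, the element against which the nets
  are measured. This serves both for the complex modulus and for the s-sum.\<close>

lemma ex_lub_combinations:
  fixes y :: "nat \<Rightarrow> 'r"
  assumes ne: "T \<noteq> {}" and bd: "\<And>p k. p \<in> T \<Longrightarrow> k < N \<Longrightarrow> \<bar>c p k\<bar> \<le> 1"
  shows "\<exists>z. is_lub ((\<lambda>p. \<Sum>k<N. c p k *\<^sub>R y k) ` T) z"
proof (rule ex_lub_if_finite_nets)
  define e where "e = (\<Sum>k<N. lat_abs (y k))"
  let ?f = "\<lambda>p. \<Sum>k<N. c p k *\<^sub>R y k"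
  show "0 \<le> (\<Sum>k<N. lat_abs (y k))" by (intro sum_nonneg lat_abs_nonneg)
  fix j :: nat
  define K where "K = real (Suc j)"
  have K: "K > 0" by (simp add: K_def)
  define cell where "cell p = (\<lambda>k\<in>{..<N}. \<lfloor>K * c p k\<rfloor>)" for p
  have "cell ` T \<subseteq> PiE {..<N} (\<lambda>_. {-\<lceil>K\<rceil>..\<lceil>K\<rceil>})"
  proof (clarsimp simp: cell_def)
    fix p k assume p: "p \<in> T" and k: "k < N"
    have "\<bar>K * c p k\<bar> \<le> K * 1"
      unfolding abs_mult using K bd[OF p k] by (intro mult_mono) auto
    then show "- \<lceil>K\<rceil> \<le> \<lfloor>K * c p k\<rfloor> \<and> \<lfloor>K * c p k\<rfloor> \<le> \<lceil>K\<rceil>" by linarith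
  qed
  then have fin: "finite (cell ` T)" by (rule finite_subset) (intro finite_PiE, auto)
  \<comment> \<open>One representative per nonempty grid cell, chosen inside \<open>T\<close>, so
    that the net consists of genuine members of the family.\<close>
  define F where "F = ?f ` inv_into T cell ` cell ` T"
  have "finite F" "F \<noteq> {}" using fin ne by (auto simp: F_def)
  moreover have "F \<subseteq> ?f ` T" unfolding F_def by (intro image_mono) (auto simp: inv_into_into)
  moreover have "\<exists>q\<in>F. x \<le> q + (1 / K) *\<^sub>R e" if x: "x \<in> ?f ` T" for x
  proof -
    obtain p where p: "p \<in> T" "x = ?f p" using x by auto
    define p' where "p' = inv_into T cell (cell p)"
    have p': "p' \<in> T" "cell p' = cell p" using p by (auto simp: p'_def inv_into_into f_inv_into_f)
    have "c p k *\<^sub>R y k \<le> c p' k *\<^sub>R y k + (1 / K) *\<^sub>R lat_abs (y k)" if k: "k < N" for k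
    proof -
      have "\<lfloor>K * c p k\<rfloor> = \<lfloor>K * c p' k\<rfloor>" using fun_cong[OF p'(2), of k] k by (simp add: cell_def)
      then have "\<bar>K * (c p k - c p' k)\<bar> \<le> 1" unfolding right_diff_distrib by linarith
      then have d: "\<bar>c p k - c p' k\<bar> \<le> 1 / K" using K
        unfolding abs_mult by (simp add: field_simps)
      have "(c p k - c p' k) *\<^sub>R y k \<le> \<bar>c p k - c p' k\<bar> *\<^sub>R lat_abs (y k)"
      proof (cases "c p k - c p' k \<ge> 0")
        case True
        then show ?thesis by (auto simp: lat_abs_def intro!: scaleR_left_mono)
      next
        case False
        have "(c p' k - c p k) *\<^sub>R (- y k) \<le> (c p' k - c p k) *\<^sub>R lat_abs (y k)"
          using False by (intro scaleR_left_mono) (auto simp: lat_abs_def)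
        with False show ?thesis by (simp add: algebra_simps)
      qed
      also have "\<dots> \<le> (1 / K) *\<^sub>R lat_abs (y k)" using d by (intro scaleR_right_mono lat_abs_nonneg)
      finally show ?thesis by (simp add: algebra_simps)
    qed
    then have "x \<le> (\<Sum>k<N. c p' k *\<^sub>R y k + (1 / K) *\<^sub>R lat_abs (y k))"
      unfolding p(2) by (intro sum_mono) auto
    also have "\<dots> = ?f p' + (1 / K) *\<^sub>R e" by (simp add: e_def sum.distrib scaleR_sum_right)
    finally show ?thesis using p by (auto simp: F_def p'_def)
  qed
  ultimately show "\<exists>F. finite F \<and> F \<noteq> {} \<and> F \<subseteq> ?f ` T \<and>
      (\<forall>p\<in>?f ` T. \<exists>q\<in>F. p \<le> q + (1 / real (Suc j)) *\<^sub>R (\<Sum>k<N. lat_abs (y k)))"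
    unfolding K_def e_def by blast
qed

text \<open>Gives meaning to the definite description in \<open>cmodulus\<close>: the supremum
  exists as an instance with two vectors and the coefficients cos \<theta>, sin \<theta>.\<close>

lemma is_lub_cmodulus:
  fixes p :: "'r \<times> 'r"
  shows "is_lub (range (\<lambda>\<theta>. cos \<theta> *\<^sub>R fst p + sin \<theta> *\<^sub>R snd p)) (cmodulus p)"
proof -
  have "\<exists>z. is_lub ((\<lambda>\<theta>. \<Sum>k<2. (if k = 0 then cos \<theta> else sin \<theta>) *\<^sub>R (if k = (0::nat) then fst p else snd p)) ` UNIV) z"
    by (rule ex_lub_combinations) auto
  then obtain z where z: "is_lub (range (\<lambda>\<theta>. cos \<theta> *\<^sub>R fst p + sin \<theta> *\<^sub>R snd p)) z"
    by (auto simp: eval_nat_numeral)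
  moreover have "cmodulus p = z"
    unfolding cmodulus_def using z
    by (intro the_equality) (auto simp: full_SetCompr_eq intro: is_lub_unique)
  ultimately show ?thesis by simp
qed

lemma cmodulus_ge: "cos \<theta> *\<^sub>R fst p + sin \<theta> *\<^sub>R snd p \<le> cmodulus (p :: 'r \<times> 'r)"
  using is_lub_cmodulus[of p] by (auto simp: is_lub_def)

lemma cmodulus_nonneg: "0 \<le> cmodulus (p :: 'r \<times> 'r)"
proof (rule ordered_half_nonneg)
  show "0 \<le> cmodulus p + cmodulus p"
    using add_mono[OF cmodulus_ge[of 0 p] cmodulus_ge[of pi p]] by simp
qed

lemma cnorm_scaleR: "r \<ge> 0 \<Longrightarrow> cnorm (r *\<^sub>R (p :: 'r \<times> 'r)) = r * cnorm p"
proof -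
  assume r: "r \<ge> 0"
  have "is_lub (range (\<lambda>\<theta>. r *\<^sub>R (cos \<theta> *\<^sub>R fst p + sin \<theta> *\<^sub>R snd p))) (r *\<^sub>R cmodulus p)"
    by (rule is_lub_scaleR[OF is_lub_cmodulus r])
  then have "cmodulus (r *\<^sub>R p) = r *\<^sub>R cmodulus p"
    using is_lub_cmodulus[of "r *\<^sub>R p"] by (intro is_lub_unique) (auto simp: algebra_simps)
  then show ?thesis using r by (simp add: cnorm_def)
qed

text \<open>The real part of c p is |c| times the member of the defining family at the angle - Arg
  c.\<close>

lemma Re_cmul_le_cmodulus:
  assumes "cmod c \<le> 1"
  shows "fst (cmul c p) \<le> cmodulus (p :: 'r \<times> 'r)"
proof -
  have "fst (cmul c p) = cmod c *\<^sub>R (cos (- Arg c) *\<^sub>R fst p + sin (- Arg c) *\<^sub>R snd p)"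
    using arg_cong[OF rcis_cmod_Arg[of c], of Re] arg_cong[OF rcis_cmod_Arg[of c], of Im]
    by (simp add: cmul_def algebra_simps)
  also have "\<dots> \<le> cmod c *\<^sub>R cmodulus p"
    by (intro scaleR_left_mono cmodulus_ge) auto
  also have "\<dots> \<le> 1 *\<^sub>R cmodulus p"
    using assms by (intro scaleR_right_mono cmodulus_nonneg)
  finally show ?thesis by simp
qed

end

subsection \<open>Mixed norms over multi-indices\<close>

text \<open>Hoelder's inequality with exponents 1/\<theta> and 1/(1-\<theta>): Young's inequality is
  summed after both sums are normalised to 1.\<close>

lemma holder_sum:
  fixes f g :: "'a \<Rightarrow> real"
  assumes A: "finite A" and fg: "\<And>x. x \<in> A \<Longrightarrow> 0 \<le> f x" "\<And>x. x \<in> A \<Longrightarrow> 0 \<le> g x"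
    and \<theta>: "0 < \<theta>" "\<theta> < 1"
  shows "(\<Sum>x\<in>A. f x powr \<theta> * g x powr (1 - \<theta>)) \<le> sum f A powr \<theta> * sum g A powr (1 - \<theta>)"
proof (cases "sum f A = 0 \<or> sum g A = 0")
  case True
  then have "f x = 0 \<or> g x = 0" if "x \<in> A" for x
    using A fg that by (auto simp: sum_nonneg_eq_0_iff)
  then have "(\<Sum>x\<in>A. f x powr \<theta> * g x powr (1 - \<theta>)) = 0"
    by (intro sum.neutral) auto
  then show ?thesis by simp
next
  case False
  define F where "F = sum f A"
  define G where "G = sum g A"
  have FG: "F > 0" "G > 0"
    using False fg by (auto simp: F_def G_def less_le sum_nonneg)
  have "f x powr \<theta> * g x powr (1 - \<theta>) \<le> F powr \<theta> * G powr (1 - \<theta>) * (\<theta> * (f x / F) + (1 - \<theta>) * (g x / G))"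
    if x: "x \<in> A" for x
  proof -
    have "(f x / F) powr \<theta> * (g x / G) powr (1 - \<theta>) \<le> \<theta> * (f x / F) + (1 - \<theta>) * (g x / G)"
    proof (cases "f x = 0 \<or> g x = 0")
      case False
      then show ?thesis using fg[OF x] FG \<theta> by (intro Youngs_inequality_0) auto
    qed (use fg[OF x] FG \<theta> in auto)
    then have "F powr \<theta> * G powr (1 - \<theta>) * ((f x / F) powr \<theta> * (g x / G) powr (1 - \<theta>))
        \<le> F powr \<theta> * G powr (1 - \<theta>) * (\<theta> * (f x / F) + (1 - \<theta>) * (g x / G))"
      by (intro mult_left_mono) auto
    then show ?thesis using FG fg x by (simp add: powr_divide)
  qed
  then have "(\<Sum>x\<in>A. f x powr \<theta> * g x powr (1 - \<theta>))
      \<le> (\<Sum>x\<in>A. F powr \<theta> * G powr (1 - \<theta>) * (\<theta> * (f x / F) + (1 - \<theta>) * (g x / G)))"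
    by (rule sum_mono)
  also have "\<dots> = F powr \<theta> * G powr (1 - \<theta>) * (\<theta> * (F / F) + (1 - \<theta>) * (G / G))"
    unfolding sum_distrib_left[symmetric] sum.distrib sum_divide_distrib[symmetric] F_def G_def by simp
  also have "\<dots> = F powr \<theta> * G powr (1 - \<theta>)" using FG by simp
  finally show ?thesis by (simp add: F_def G_def)
qed

lemma power_mean_sum:
  fixes f :: "'a \<Rightarrow> real"
  assumes A: "finite A" and f: "\<And>x. x \<in> A \<Longrightarrow> 0 \<le> f x" and t: "1 \<le> t"
  shows "(sum f A / card A) powr t \<le> (\<Sum>x\<in>A. f x powr t) / card A"
proof (cases "t = 1 \<or> A = {}")
  case True
  then show ?thesis using f by (auto simp: sum_nonneg)
next
  case False
  with t have t1: "t > 1" by simp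
  have card: "card A > 0" using A False by (simp add: card_gt_0_iff)
  have "sum f A = (\<Sum>x\<in>A. (f x powr t) powr (1 / t) * 1 powr (1 - 1 / t))"
    using f t1 by (intro sum.cong) (auto simp: powr_powr)
  also have "\<dots> \<le> (\<Sum>x\<in>A. f x powr t) powr (1 / t) * (\<Sum>x\<in>A. 1) powr (1 - 1 / t)"
    using t1 by (intro holder_sum A) auto
  finally have "sum f A powr t \<le> ((\<Sum>x\<in>A. f x powr t) powr (1 / t) * real (card A) powr (1 - 1 / t)) powr t"
    using f t by (intro powr_mono2) (auto intro: sum_nonneg)
  also have "\<dots> = (\<Sum>x\<in>A. f x powr t) * real (card A) powr (t - 1)"
    using t1 by (simp add: powr_mult powr_powr sum_nonneg algebra_simps)
  finally show ?thesis
    using card by (simp add: powr_divide sum_nonneg f powr_diff field_simps)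
qed

text \<open>Convexity of exp at the points m ln (p j) with weights \<alpha> j / m. Restriction to
  the support of \<alpha> keeps the logarithms meaningful; a vanishing factor in the support makes
  the product 0.\<close>

lemma weighted_am_gm:
  fixes p :: "nat \<Rightarrow> real"
  assumes p: "\<And>j. j < n \<Longrightarrow> 0 \<le> p j" and \<alpha>: "\<alpha> \<in> multi_indices n m" and m: "m > 0"
  shows "(\<Prod>j<n. p j ^ \<alpha> j) \<le> (\<Sum>j<n. real (\<alpha> j) / m * p j ^ m)"
proof (cases "\<exists>j<n. \<alpha> j > 0 \<and> p j = 0")
  case True
  then have "(\<Prod>j<n. p j ^ \<alpha> j) = 0" by auto
  also have "\<dots> \<le> (\<Sum>j<n. real (\<alpha> j) / m * p j ^ m)" using p by (auto intro!: sum_nonneg)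
  finally show ?thesis .
next
  case False
  define J where "J = {j. j < n \<and> \<alpha> j > 0}"
  have J: "finite J" "J \<subseteq> {..<n}" by (auto simp: J_def)
  have pos: "p j > 0" if "j \<in> J" for j   proof -
    have "j < n" "\<alpha> j > 0" using that by (auto simp: J_def)
    then show ?thesis using False p[of j] by force
  qed
  have sum1: "(\<Sum>j\<in>J. real (\<alpha> j) / m) = 1"
  proof -
    have "(\<Sum>j\<in>J. \<alpha> j) = (\<Sum>j<n. \<alpha> j)"
      by (rule sum.mono_neutral_left) (auto simp: J_def)
    then have "(\<Sum>j\<in>J. \<alpha> j) = m" using \<alpha> by (simp add: multi_indices_def)
    then have "real m = (\<Sum>j\<in>J. real (\<alpha> j))" by (simp flip: of_nat_sum)
    then show ?thesis using m by (simp flip: sum_divide_distrib)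
  qed
  then have J0: "J \<noteq> {}" by auto
  have "(\<Prod>j<n. p j ^ \<alpha> j) = (\<Prod>j\<in>J. p j ^ \<alpha> j)"
    by (rule prod.mono_neutral_right) (auto simp: J_def)
  also have "\<dots> = (\<Prod>j\<in>J. exp (real (\<alpha> j) / m * (real m * ln (p j))))"
    using pos m by (intro prod.cong refl) (simp add: exp_of_nat_mult)
  also have "\<dots> = exp (\<Sum>j\<in>J. (real (\<alpha> j) / m) *\<^sub>R (real m * ln (p j)))"
    using J by (simp add: exp_sum)
  also have "\<dots> \<le> (\<Sum>j\<in>J. real (\<alpha> j) / m * exp (real m * ln (p j)))"
    by (rule convex_on_sum[OF J(1) J0 exp_convex sum1]) auto
  also have "\<dots> = (\<Sum>j\<in>J. real (\<alpha> j) / m * p j ^ m)"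
    using pos by (intro sum.cong refl) (simp add: exp_of_nat_mult)
  also have "\<dots> \<le> (\<Sum>j<n. real (\<alpha> j) / m * p j ^ m)"
    using J p by (intro sum_mono2) auto
  finally show ?thesis .
qed

text \<open>Each monomial occurs in the expansion of the power with a multinomial coefficient at
  least 1. In the induction, raising one coordinate reaches every index of the next degree, possibly
  several times, whence the inequality.\<close>

lemma sum_monomials_le:
  fixes v :: "nat \<Rightarrow> real"
  assumes v: "\<And>j. j < n \<Longrightarrow> 0 \<le> v j"
  shows "(\<Sum>\<alpha>\<in>multi_indices n m. \<Prod>j<n. v j ^ \<alpha> j) \<le> (\<Sum>j<n. v j) ^ m"
proof (induction m)
  case 0
  have "\<alpha> = (\<lambda>_. 0)" if "\<alpha> \<in> multi_indices n 0" for \<alpha>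
    using multi_index_le[OF that] by auto
  then have "multi_indices n 0 = {\<lambda>_. 0}" by (auto simp: multi_indices_def)
  then show ?case by simp
next
  case (Suc m)
  let ?up = "\<lambda>(j, \<alpha>). \<alpha>(j := Suc (\<alpha> j))"
  let ?D = "{..<n} \<times> multi_indices n m"
  let ?w = "\<lambda>\<alpha>. \<Prod>j<n. v j ^ \<alpha> j"
  have w0: "?w \<alpha> \<ge> 0" for \<alpha> using v by (intro prod_nonneg) auto
  have fin: "finite ?D" using finite_multi_indices by auto
  have "multi_indices n (Suc m) \<subseteq> ?up ` ?D"
  proof
    fix \<alpha> assume \<alpha>: "\<alpha> \<in> multi_indices n (Suc m)"
    then have "(\<Sum>i<n. \<alpha> i) \<noteq> 0" by (simp add: multi_indices_def)
    then obtain j where j: "j < n" "\<alpha> j > 0" by (metis gr0I lessThan_iff sum.neutral)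
    define \<beta> where "\<beta> = \<alpha>(j := \<alpha> j - 1)"
    have "(\<Sum>i<n. \<alpha> i) = Suc (\<Sum>i<n. \<beta> i)"
      using j by (simp add: \<beta>_def sum.remove[of "{..<n}" j])
    then have "\<beta> \<in> multi_indices n m" using \<alpha> j by (auto simp: multi_indices_def \<beta>_def)
    moreover have "\<alpha> = ?up (j, \<beta>)" using j by (auto simp: \<beta>_def)
    ultimately show "\<alpha> \<in> ?up ` ?D" using j by blast
  qed
  then have "sum ?w (multi_indices n (Suc m)) \<le> sum ?w (?up ` ?D)"
    using fin w0 by (intro sum_mono2) auto
  also have "\<dots> \<le> (\<Sum>x\<in>?D. ?w (?up x))"
    using sum_image_le[OF fin, of ?w ?up] w0 by (simp add: o_def)
  also have "\<dots> = (\<Sum>(j, \<alpha>)\<in>?D. v j * ?w \<alpha>)"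
  proof (intro sum.cong refl, clarify)
    fix j \<alpha> assume j: "j < n"
    have "(\<Prod>i\<in>{..<n} - {j}. v i ^ (\<alpha>(j := Suc (\<alpha> j))) i) = (\<Prod>i\<in>{..<n} - {j}. v i ^ \<alpha> i)"
      by (intro prod.cong) auto
    then show "?w (\<alpha>(j := Suc (\<alpha> j))) = v j * ?w \<alpha>"
      using j by (simp add: prod.remove[of "{..<n}" j])
  qed
  also have "\<dots> = (\<Sum>j<n. v j) * sum ?w (multi_indices n m)"
    by (simp add: sum_product sum.cartesian_product)
  also have "\<dots> \<le> (\<Sum>j<n. v j) * (\<Sum>j<n. v j) ^ m"
    using v by (intro mult_left_mono Suc sum_nonneg) auto
  finally show ?case by simp
qed

lemma multi_index_average:
  assumes "m > 0"
  shows "(\<Sum>\<alpha>\<in>multi_indices n m. f \<alpha>) = (\<Sum>\<alpha>\<in>multi_indices n m. \<Sum>j<n. real (\<alpha> j) / m * f \<alpha>)"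
proof (intro sum.cong refl)
  fix \<alpha> assume "\<alpha> \<in> multi_indices n m"
  then have "real m = (\<Sum>j<n. real (\<alpha> j))" by (simp add: multi_indices_def flip: of_nat_sum)
  then show "f \<alpha> = (\<Sum>j<n. real (\<alpha> j) / m * f \<alpha>)"
    using assms by (simp flip: sum_divide_distrib sum_distrib_right)
qed

text \<open>A variant of Blei's inequality for multi-indices: Hoelder's inequality splits
\<open>x\<^sup>\<beta>\<close> into a power of \<open>x\<^sup>s \<Prod>\<^sub>j u\<^sub>j\<^bsup>-(s-t)\<alpha>\<^sub>j/m\<^esup>\<close> and one of \<open>\<Prod>\<^sub>j u\<^sub>j\<^bsup>t\<alpha>\<^sub>j\<^esup>\<close>.\<close>

lemma multi_index_mixed_norm:
  fixes x :: "(nat \<Rightarrow> nat) \<Rightarrow> real"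
  assumes m: "m > 0" and t: "0 < t" "t \<le> s"
    and \<beta>: "\<beta> = real m * s * t / (s + (real m - 1) * t)"
    and x: "\<And>\<alpha>. \<alpha> \<in> multi_indices n m \<Longrightarrow> 0 \<le> x \<alpha>"
    and u: "\<And>j. j < n \<Longrightarrow> 0 \<le> u j"
    and mixed: "\<And>j. j < n \<Longrightarrow> (\<Sum>\<alpha>\<in>multi_indices n m. real (\<alpha> j) / m * x \<alpha> powr s) \<le> u j powr s"
  shows "(\<Sum>\<alpha>\<in>multi_indices n m. x \<alpha> powr \<beta>) \<le> (\<Sum>j<n. u j powr t) powr (\<beta> / t)"
proof (cases "s = t")
  \<comment> \<open>Here \<beta>/s = 1, outside the range of Hoelder's inequality; but then \<beta>
    = t, and averaging with the weights \<alpha> j / m suffices.\<close>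
  case True
  have "\<beta> = t" using m t True unfolding \<beta> by (simp add: field_simps)
  have "(\<Sum>\<alpha>\<in>multi_indices n m. x \<alpha> powr t) = (\<Sum>j<n. \<Sum>\<alpha>\<in>multi_indices n m. real (\<alpha> j) / m * x \<alpha> powr t)"
    by (subst multi_index_average[OF m]) (rule sum.swap)
  also have "\<dots> \<le> (\<Sum>j<n. u j powr t)" using mixed True by (intro sum_mono) auto
  finally show ?thesis using t \<open>\<beta> = t\<close> by (simp add: sum_nonneg)
next
  case False
  with t have st: "t < s" by simp
  define D where "D = s + (real m - 1) * t"
  have D: "D > 0" using st t m by (auto simp: D_def intro!: add_pos_nonneg)
  define \<theta> where "\<theta> = \<beta> / s"
  have \<theta>_eq: "\<theta> = m * t / D" using t st by (simp add: \<theta>_def \<beta> D_def)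
  have \<theta>: "0 < \<theta>" "\<theta> < 1"
    using m t D st by (simp_all add: \<theta>_eq) (simp_all add: D_def algebra_simps)
  have \<beta>s: "\<beta> = s * \<theta>" using t by (simp add: \<theta>_def)
  \<comment> \<open>The exponent is fixed by u^s p^m = u^t; with \<theta> = \<beta>/s the powers of
    u in the two Hoelder factors then cancel exactly.\<close>
  define p where "p j = u j powr (- (s - t) / m)" for j
  define v where "v j = u j powr t" for j
  define T where "T = {\<alpha> \<in> multi_indices n m. x \<alpha> > 0}"
  have finT: "finite T" "T \<subseteq> multi_indices n m" using finite_multi_indices by (auto simp: T_def)
  \<comment> \<open>That cancellation fails at u = 0, where \<open>0 powr _\<close> is 0. A positive
    x \<alpha> with \<alpha> j > 0 excludes this case through \<open>mixed\<close>.\<close>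
  have upos: "u j > 0" if "\<alpha> \<in> T" "j < n" "\<alpha> j > 0" for \<alpha> j
  proof -
    have "0 < real (\<alpha> j) / m * x \<alpha> powr s" using that m by (auto simp: T_def)
    also have "\<dots> \<le> (\<Sum>\<alpha>\<in>multi_indices n m. real (\<alpha> j) / m * x \<alpha> powr s)"
      using that by (intro member_le_sum finite_multi_indices) (auto simp: T_def)
    also have "\<dots> \<le> u j powr s" using mixed that by blast
    finally show ?thesis using u[OF that(2)] by (cases "u j = 0") auto
  qed
  let ?f = "\<lambda>\<alpha>. x \<alpha> powr s * (\<Prod>j<n. p j ^ \<alpha> j)" and ?g = "\<lambda>\<alpha>. \<Prod>j<n. v j ^ \<alpha> j"
  have p0: "p j \<ge> 0" and v0: "v j \<ge> 0" for j by (auto simp: p_def v_def)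
  have f0: "?f \<alpha> \<ge> 0" and g0: "?g \<alpha> \<ge> 0" for \<alpha>
    using p0 v0 by (auto intro!: mult_nonneg_nonneg prod_nonneg)
  have split: "x \<alpha> powr \<beta> = ?f \<alpha> powr \<theta> * ?g \<alpha> powr (1 - \<theta>)" if \<alpha>: "\<alpha> \<in> T" for \<alpha>
  proof -
    have one: "(p j ^ \<alpha> j) powr \<theta> * (v j ^ \<alpha> j) powr (1 - \<theta>) = 1" if j: "j < n" for j
    proof (cases "\<alpha> j = 0")
      case False
      then have uj: "u j > 0" using upos[OF \<alpha> j] by simp
      have e: "- (s - t) / m * \<theta> + t * (1 - \<theta>) = 0"
        using D m unfolding \<theta>_eq by (simp add: field_simps) (simp add: D_def algebra_simps)
      have "(p j ^ \<alpha> j) powr \<theta> * (v j ^ \<alpha> j) powr (1 - \<theta>) = (p j powr \<theta> * v j powr (1 - \<theta>)) ^ \<alpha> j"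
        using uj by (simp add: p_def v_def powr_power power_mult_distrib powr_powr mult_ac)
      also have "p j powr \<theta> * v j powr (1 - \<theta>) = 1"
        using uj e by (simp add: p_def v_def powr_powr flip: powr_add)
      finally show ?thesis by simp
    qed simp
    have "?f \<alpha> powr \<theta> * ?g \<alpha> powr (1 - \<theta>)
        = x \<alpha> powr \<beta> * (\<Prod>j<n. (p j ^ \<alpha> j) powr \<theta> * (v j ^ \<alpha> j) powr (1 - \<theta>))"
      using p0 v0
      by (simp add: powr_mult prod_nonneg prod_powr_distrib prod.distrib powr_powr \<beta>s)
    also have "(\<Prod>j<n. (p j ^ \<alpha> j) powr \<theta> * (v j ^ \<alpha> j) powr (1 - \<theta>)) = 1"
      by (intro prod.neutral) (simp add: one)
    finally show ?thesis by simp
  qed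
  have sumf: "sum ?f T \<le> (\<Sum>j<n. u j powr t)"
  proof -
    have "sum ?f T \<le> sum ?f (multi_indices n m)"
      using finT finite_multi_indices f0 by (intro sum_mono2) auto
    \<comment> \<open>AM-GM trades the product over j for a sum with the weights \<alpha> j / m,
      which is the form that \<open>mixed\<close> controls.\<close>
    also have "\<dots> \<le> (\<Sum>\<alpha>\<in>multi_indices n m. x \<alpha> powr s * (\<Sum>j<n. real (\<alpha> j) / m * p j ^ m))"
      using p0 m by (intro sum_mono mult_left_mono weighted_am_gm) auto
    also have "\<dots> = (\<Sum>j<n. (\<Sum>\<alpha>\<in>multi_indices n m. real (\<alpha> j) / m * x \<alpha> powr s) * p j ^ m)"
      by (simp add: sum_distrib_left sum_distrib_right mult_ac) (rule sum.swap)
    also have "\<dots> \<le> (\<Sum>j<n. u j powr s * p j ^ m)"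
      using mixed p0 by (intro sum_mono mult_right_mono) auto
    also have "\<dots> = (\<Sum>j<n. u j powr t)"
    proof (intro sum.cong refl)
      fix j assume "j \<in> {..<n}"
      then have "u j \<ge> 0" using u by simp
      then show "u j powr s * p j ^ m = u j powr t"
        using m by (cases "u j = 0") (auto simp: p_def powr_power simp flip: powr_add)
    qed
    finally show ?thesis .
  qed
  have sumg: "sum ?g T \<le> (\<Sum>j<n. u j powr t) ^ m"
  proof -
    have "sum ?g T \<le> sum ?g (multi_indices n m)"
      using finT finite_multi_indices g0 by (intro sum_mono2) auto
    also have "\<dots> \<le> (\<Sum>j<n. v j) ^ m" using v0 by (intro sum_monomials_le) auto
    finally show ?thesis by (simp add: v_def)
  qed
  let ?V = "\<Sum>j<n. u j powr t"
  have V0: "?V \<ge> 0" by (intro sum_nonneg) auto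
  have "(\<Sum>\<alpha>\<in>multi_indices n m. x \<alpha> powr \<beta>) = (\<Sum>\<alpha>\<in>T. x \<alpha> powr \<beta>)"
    using finite_multi_indices x by (intro sum.mono_neutral_right) (auto simp: T_def less_le)
  also have "\<dots> = (\<Sum>\<alpha>\<in>T. ?f \<alpha> powr \<theta> * ?g \<alpha> powr (1 - \<theta>))"
    by (intro sum.cong split refl)
  also have "\<dots> \<le> sum ?f T powr \<theta> * sum ?g T powr (1 - \<theta>)"
    using finT \<theta> f0 g0 by (intro holder_sum) auto
  also have "\<dots> \<le> ?V powr \<theta> * (?V ^ m) powr (1 - \<theta>)"
    using sumf sumg f0 g0 \<theta> by (intro mult_mono powr_mono2) (auto intro: sum_nonneg)
  also have "\<dots> = ?V powr (\<beta> / t)"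
  proof (cases "?V = 0")
    case False
    with V0 have V: "?V > 0" by simp
    have e: "\<theta> + m * (1 - \<theta>) = \<beta> / t"
      using D m t unfolding \<beta>s \<theta>_eq by (simp add: field_simps) (simp add: D_def algebra_simps)
    have "(?V ^ m) powr (1 - \<theta>) = ?V powr (m * (1 - \<theta>))"
      using V by (simp add: powr_powr flip: powr_realpow)
    then show ?thesis using e by (simp flip: powr_add)
  next
    case True
    then show ?thesis using \<theta> by simp
  qed
  finally show ?thesis .
qed

section \<open>Directional derivatives of scalar polynomials\<close>

lemma monom_scale: 
  assumes "\<alpha> \<in> multi_indices n m"
  shows "monom n \<alpha> (\<lambda>i. c * z i) = c ^ m * monom n \<alpha> z"
  using assms by (simp add: monom_def power_mult_distrib prod.distrib multi_indices_def flip: power_sum)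

lemma monom_mult: "monom n \<alpha> (\<lambda>i. w i * z i) = monom n \<alpha> w * monom n \<alpha> z"
  by (simp add: monom_def power_mult_distrib prod.distrib)

lemma monom_cong: "(\<And>i. i < n \<Longrightarrow> w i = z i) \<Longrightarrow> monom n \<alpha> w = monom n \<alpha> z"
  by (simp add: monom_def)

lemma DERIV_monom_line:
  "((\<lambda>x. monom n \<alpha> (\<lambda>i. 1 + x * \<mu> i)) has_field_derivative (\<Sum>j<n. of_nat (\<alpha> j) * \<mu> j)) (at (0::complex))"
proof (induction n)
  case (Suc n)
  have "((\<lambda>x. monom n \<alpha> (\<lambda>i. 1 + x * \<mu> i) * (1 + x * \<mu> n) ^ \<alpha> n) has_field_derivative
     (\<Sum>j<Suc n. of_nat (\<alpha> j) * \<mu> j)) (at 0)"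
    by (rule derivative_eq_intros Suc refl)+ (simp add: monom_def algebra_simps)
  then show ?case by (simp add: monom_def)
qed (simp add: monom_def)

text \<open>The sum on the left is the derivative at \<open>0\<close> of \<open>\<lambda> \<mapsto> p ((1 + \<lambda>\<mu>\<^sub>j) w\<^sub>j)\<^sub>j\<close> for suitable
unimodular \<open>\<mu>\<^sub>j\<close>, so Cauchy's estimate on the unit circle applies.\<close>

lemma sum_partial_derivatives_le:
  assumes B: "\<And>v. (\<And>i. i < n \<Longrightarrow> cmod (v i) \<le> 1) \<Longrightarrow> cmod (\<Sum>\<alpha>\<in>multi_indices n m. c \<alpha> * monom n \<alpha> v) \<le> B"
    and w: "\<And>i. i < n \<Longrightarrow> cmod (w i) \<le> 1"
  shows "(\<Sum>j<n. cmod (\<Sum>\<alpha>\<in>multi_indices n m. of_nat (\<alpha> j) * c \<alpha> * monom n \<alpha> w)) \<le> 2 ^ m * B"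
proof -
  define E where "E j = (\<Sum>\<alpha>\<in>multi_indices n m. of_nat (\<alpha> j) * c \<alpha> * monom n \<alpha> w)" for j
  define \<mu> where "\<mu> j = cnj (sgn (E j))" for j
  have \<mu>1: "cmod (\<mu> j) \<le> 1" for j by (simp add: \<mu>_def norm_sgn)
  have \<mu>E: "\<mu> j * E j = of_real (cmod (E j))" for j
    using complex_norm_square[of "E j"]
    by (cases "E j = 0") (auto simp: \<mu>_def sgn_eq power2_eq_square mult.commute nonzero_divide_eq_eq)
  define f where "f x = (\<Sum>\<alpha>\<in>multi_indices n m. c \<alpha> * monom n \<alpha> w * monom n \<alpha> (\<lambda>i. 1 + x * \<mu> i))" for x
  have "(f has_field_derivative (\<Sum>\<alpha>\<in>multi_indices n m. c \<alpha> * monom n \<alpha> w * (\<Sum>j<n. of_nat (\<alpha> j) * \<mu> j))) (at 0)"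
    unfolding f_def by (intro DERIV_sum DERIV_cmult DERIV_monom_line)
  moreover have "(\<Sum>\<alpha>\<in>multi_indices n m. c \<alpha> * monom n \<alpha> w * (\<Sum>j<n. of_nat (\<alpha> j) * \<mu> j)) = (\<Sum>j<n. \<mu> j * E j)"
    unfolding E_def sum_distrib_left by (subst sum.swap) (simp add: mult_ac)
  ultimately have deriv: "deriv f 0 = of_real (\<Sum>j<n. cmod (E j))"
    by (simp add: \<mu>E DERIV_imp_deriv)
  have hol: "f holomorphic_on UNIV"
    unfolding f_def monom_def by (intro holomorphic_intros)
  have bound: "cmod (f x) \<le> 2 ^ m * B" if x: "cmod (0 - x) = 1" for x
  proof -
    \<comment> \<open>On the unit circle |1 + x \<mu> i| \<le> 2, so halving returns to the
      polydisc; m-homogeneity makes this cost the factor 2^m.\<close>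
    define v where "v i = (1/2) * (w i * (1 + x * \<mu> i))" for i
    have "monom n \<alpha> v = (1/2) ^ m * (monom n \<alpha> w * monom n \<alpha> (\<lambda>i. 1 + x * \<mu> i))"
      if "\<alpha> \<in> multi_indices n m" for \<alpha>
      unfolding v_def by (subst monom_scale[OF that]) (simp only: monom_mult)
    then have "f x = 2 ^ m * (\<Sum>\<alpha>\<in>multi_indices n m. c \<alpha> * monom n \<alpha> v)"
      unfolding f_def sum_distrib_left
      by (intro sum.cong refl) (simp add: power_divide)
    moreover have "cmod (\<Sum>\<alpha>\<in>multi_indices n m. c \<alpha> * monom n \<alpha> v) \<le> B"
    proof (rule B)
      fix i assume i: "i < n"
      have "cmod (1 + x * \<mu> i) \<le> cmod 1 + cmod (x * \<mu> i)" by (rule norm_triangle_ineq)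
      also have "\<dots> \<le> 2" using x \<mu>1[of i] by (simp add: norm_mult)
      finally have "cmod (w i) * cmod (1 + x * \<mu> i) \<le> 1 * 2" using w[OF i] by (intro mult_mono) auto
      then show "cmod (v i) \<le> 1" by (simp add: v_def norm_mult)
    qed
    ultimately show ?thesis by (simp add: norm_mult norm_power)
  qed
  have "cmod ((deriv ^^ 1) f 0) \<le> fact 1 * (2 ^ m * B) / 1 ^ 1"
    using hol bound by (intro Cauchy_inequality) (auto intro: holomorphic_on_subset holomorphic_on_imp_continuous_on)
  then have "norm (complex_of_real (\<Sum>j<n. cmod (E j))) \<le> 2 ^ m * B" by (simp add: deriv)
  then show ?thesis unfolding E_def by (metis (no_types, lifting) norm_of_real abs_ge_self order_trans)
qed

subsection \<open>Lattice-valued polynomials\<close>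

lemma cmul_cmul: "cmul c (cmul d p) = cmul (c * d) p"
  by (simp add: cmul_def algebra_simps)

lemma cmul_sum: "cmul c (\<Sum>\<alpha>\<in>A. p \<alpha>) = (\<Sum>\<alpha>\<in>A. cmul c (p \<alpha>))"
  by (rule prod_eqI) (simp_all add: cmul_def fst_sum snd_sum scaleR_sum_right sum_subtractf sum.distrib)

lemma sum_cmul: "(\<Sum>g\<in>G. cmul (c g) p) = cmul (\<Sum>g\<in>G. c g) p"
  by (rule prod_eqI) (simp_all add: cmul_def fst_sum snd_sum scaleR_sum_left sum_subtractf sum.distrib)

text \<open>The scalar inequality between the two sides lifts to a Banach lattice because, by duality,
its left-hand side is an average of the values \<open>Q(g)\<close> with bounded complex weights.\<close>

lemma lattice_khinchine:
  fixes b :: "'i \<Rightarrow> ('r::{banach, ordered_real_vector, lattice}) \<times> 'r"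
    and e :: "'i \<Rightarrow> 'g \<Rightarrow> complex"
  assumes lat: "banach_lattice TYPE('r)"
    and A: "finite A" and G: "finite G" and K: "K \<ge> 0"
    and L1L2: "\<And>c. sqrt (\<Sum>\<alpha>\<in>A. (cmod (c \<alpha>))\<^sup>2) \<le> K * (\<Sum>g\<in>G. cmod (\<Sum>\<alpha>\<in>A. c \<alpha> * e \<alpha> g))"
    and a: "(\<Sum>\<alpha>\<in>A. (a \<alpha>)\<^sup>2) \<le> 1"
  shows "(\<Sum>\<alpha>\<in>A. a \<alpha> *\<^sub>R cmodulus (b \<alpha>)) \<le> K *\<^sub>R (\<Sum>g\<in>G. cmodulus (\<Sum>\<alpha>\<in>A. cmul (e \<alpha> g) (b \<alpha>)))"
    (is "_ \<le> ?V")
proof -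
  let ?Q = "\<lambda>g. \<Sum>\<alpha>\<in>A. cmul (e \<alpha> g) (b \<alpha>)"
  have "(\<Sum>\<alpha>\<in>A. a \<alpha> *\<^sub>R cmodulus (b \<alpha>)) \<le> (\<Sum>\<alpha>\<in>A. \<bar>a \<alpha>\<bar> *\<^sub>R cmodulus (b \<alpha>))"
    by (intro sum_mono scaleR_right_mono cmodulus_nonneg lat) auto
  also have "\<dots> \<le> ?V"
  proof (rule sum_lub_le[OF A])
    fix \<alpha>
    show "is_lub (range (\<lambda>\<theta>. \<bar>a \<alpha>\<bar> *\<^sub>R (cos \<theta> *\<^sub>R fst (b \<alpha>) + sin \<theta> *\<^sub>R snd (b \<alpha>)))) (\<bar>a \<alpha>\<bar> *\<^sub>R cmodulus (b \<alpha>))"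
      by (intro is_lub_scaleR is_lub_cmodulus lat) auto
  next
    fix \<theta> :: "'i \<Rightarrow> real"
    \<comment> \<open>Encodes the angles in complex coefficients with the same moduli as
      \<open>a\<close>: the real part of d \<alpha> b \<alpha> is the rotated real part at angle
      \<theta> \<alpha>, scaled by |a \<alpha>|.\<close>
    define d where "d \<alpha> = of_real \<bar>a \<alpha>\<bar> * cis (- \<theta> \<alpha>)" for \<alpha>
    have "(\<Sum>\<alpha>\<in>A. (cmod (d \<alpha>))\<^sup>2) \<le> 1" using a by (simp add: d_def norm_mult)
    then obtain h where h: "\<And>g. cmod (h g) \<le> 1"
      and dh: "\<And>\<alpha>. \<alpha> \<in> A \<Longrightarrow> d \<alpha> = K * (\<Sum>g\<in>G. h g * e \<alpha> g)"
      using bounded_interpolation[OF A G K L1L2] by blast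
    have "(\<Sum>\<alpha>\<in>A. \<bar>a \<alpha>\<bar> *\<^sub>R (cos (\<theta> \<alpha>) *\<^sub>R fst (b \<alpha>) + sin (\<theta> \<alpha>) *\<^sub>R snd (b \<alpha>)))
        = fst (\<Sum>\<alpha>\<in>A. cmul (d \<alpha>) (b \<alpha>))"
      unfolding fst_sum by (intro sum.cong refl) (simp add: cmul_def d_def scaleR_add_right)
    also have "(\<Sum>\<alpha>\<in>A. cmul (d \<alpha>) (b \<alpha>)) = (\<Sum>\<alpha>\<in>A. \<Sum>g\<in>G. cmul (K * (h g * e \<alpha> g)) (b \<alpha>))"
      by (intro sum.cong refl) (simp add: dh sum_cmul sum_distrib_left)
    also have "\<dots> = (\<Sum>g\<in>G. cmul K (cmul (h g) (?Q g)))"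
      by (subst sum.swap) (simp add: cmul_sum cmul_cmul)
    also have "fst \<dots> = K *\<^sub>R (\<Sum>g\<in>G. fst (cmul (h g) (?Q g)))"
      unfolding fst_sum scaleR_sum_right by (intro sum.cong refl) (simp add: cmul_def)
    also have "\<dots> \<le> ?V"
      using K by (intro scaleR_left_mono sum_mono Re_cmul_le_cmodulus lat h)
    finally show "(\<Sum>\<alpha>\<in>A. \<bar>a \<alpha>\<bar> *\<^sub>R (cos (\<theta> \<alpha>) *\<^sub>R fst (b \<alpha>) + sin (\<theta> \<alpha>) *\<^sub>R snd (b \<alpha>))) \<le> ?V" .
  qed
  finally show ?thesis .
qed

text \<open>Every combination in the s-sum of the moduli has coefficients in the unit ball of l_2,
  hence lies below the Khinchine average. So does their supremum, and monotonicity of the norm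
  transfers the bound to the norm of the s-sum.\<close>

lemma s_concave_cnorm_sum_le:
  fixes b :: "'i \<Rightarrow> ('r::{banach, ordered_real_vector, lattice}) \<times> 'r"
    and e :: "'i \<Rightarrow> 'g \<Rightarrow> complex"
  assumes lat: "banach_lattice TYPE('r)" and s: "2 \<le> s" and M: "M \<ge> 0"
    and concave: "\<And>N (y :: nat \<Rightarrow> 'r) z. lat_psum s N y z \<Longrightarrow> (\<Sum>k<N. norm (y k) powr s) powr (1 / s) \<le> M * norm z"
    and A: "finite A" and G: "finite G" and K: "K \<ge> 0"
    and L1L2: "\<And>c. sqrt (\<Sum>\<alpha>\<in>A. (cmod (c \<alpha>))\<^sup>2) \<le> K * (\<Sum>g\<in>G. cmod (\<Sum>\<alpha>\<in>A. c \<alpha> * e \<alpha> g))"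
  shows "(\<Sum>\<alpha>\<in>A. cnorm (b \<alpha>) powr s) powr (1 / s) \<le> M * (K * (\<Sum>g\<in>G. cnorm (\<Sum>\<alpha>\<in>A. cmul (e \<alpha> g) (b \<alpha>))))"
proof -
  \<comment> \<open>An enumeration of \<open>A\<close>, as the s-sum is formed over an initial
    segment of the naturals.\<close>
  obtain \<pi> where \<pi>: "bij_betw \<pi> {..<card A} A"
    using ex_bij_betw_nat_finite[OF A] by (auto simp: atLeast0LessThan)
  let ?N = "card A"
  define y where "y k = cmodulus (b (\<pi> k))" for k
  define T where "T = {a :: nat \<Rightarrow> real. (\<Sum>k<?N. \<bar>a k\<bar> powr (s / (s - 1))) \<le> 1}"
  have s': "0 < s / (s - 1)" "s / (s - 1) \<le> 2" using s by (auto simp: field_simps)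
  have le1: "\<bar>a k\<bar> \<le> 1" if a: "a \<in> T" and k: "k < ?N" for a k
  proof (rule ccontr)
    assume "\<not> \<bar>a k\<bar> \<le> 1"
    then have "1 powr (s / (s - 1)) < \<bar>a k\<bar> powr (s / (s - 1))"
      using s' by (intro powr_less_mono2) auto
    also have "\<dots> \<le> (\<Sum>k<?N. \<bar>a k\<bar> powr (s / (s - 1)))" using k by (intro member_le_sum) auto
    finally show False using a by (simp add: T_def)
  qed
  have "(\<lambda>_. 0) \<in> T" by (simp add: T_def)
  then have "T \<noteq> {}" by blast
  then obtain z where z: "is_lub ((\<lambda>a. \<Sum>k<?N. a k *\<^sub>R y k) ` T) z"
    using ex_lub_combinations[OF lat, of T ?N "\<lambda>a k. a k" y] le1 by blast
  then have psum: "lat_psum s ?N y z"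
    by (simp add: lat_psum_def T_def setcompr_eq_image)
  define V where "V = K *\<^sub>R (\<Sum>g\<in>G. cmodulus (\<Sum>\<alpha>\<in>A. cmul (e \<alpha> g) (b \<alpha>)))"
  have z0: "0 \<le> z" using z \<open>(\<lambda>_. 0) \<in> T\<close> by (force simp: is_lub_def)
  have "z \<le> V"
  proof -
    have "(\<Sum>k<?N. a k *\<^sub>R y k) \<le> V" if a: "a \<in> T" for a
    proof -
      define a' where "a' \<alpha> = a (inv_into {..<?N} \<pi> \<alpha>)" for \<alpha>
      have a'\<pi>: "a' (\<pi> k) = a k" if "k < ?N" for k
        using that \<pi> by (simp add: a'_def bij_betw_def)
      have "(\<Sum>k<?N. (a k)\<^sup>2) \<le> (\<Sum>k<?N. \<bar>a k\<bar> powr (s / (s - 1)))"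
      proof (intro sum_mono)
        fix k assume "k \<in> {..<?N}"
        \<comment> \<open>For a base at most 1 the larger exponent gives the smaller power.\<close>
        then have "\<bar>a k\<bar> powr 2 \<le> \<bar>a k\<bar> powr (s / (s - 1))"
          using le1[OF a] s' by (intro powr_mono') auto
        then show "(a k)\<^sup>2 \<le> \<bar>a k\<bar> powr (s / (s - 1))"
          by (cases "a k = 0") (simp_all add: powr_numeral)
      qed
      also have "\<dots> \<le> 1" using a by (simp add: T_def)
      also have "(\<Sum>k<?N. (a k)\<^sup>2) = (\<Sum>k<?N. (a' (\<pi> k))\<^sup>2)" by (simp add: a'\<pi>)
      also have "\<dots> = (\<Sum>\<alpha>\<in>A. (a' \<alpha>)\<^sup>2)" by (rule sum.reindex_bij_betw[OF \<pi>])
      finally have "(\<Sum>\<alpha>\<in>A. a' \<alpha> *\<^sub>R cmodulus (b \<alpha>)) \<le> V"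
        unfolding V_def by (intro lattice_khinchine lat A G K L1L2)
      moreover have "(\<Sum>\<alpha>\<in>A. a' \<alpha> *\<^sub>R cmodulus (b \<alpha>)) = (\<Sum>k<?N. a' (\<pi> k) *\<^sub>R cmodulus (b (\<pi> k)))"
        by (rule sum.reindex_bij_betw[OF \<pi>, symmetric])
      ultimately show ?thesis by (simp add: a'\<pi> y_def)
    qed
    then show ?thesis using z by (auto simp: is_lub_def)
  qed
  then have "norm z \<le> norm V" by (rule norm_mono_nonneg[OF lat z0])
  also have "\<dots> \<le> K * (\<Sum>g\<in>G. cnorm (\<Sum>\<alpha>\<in>A. cmul (e \<alpha> g) (b \<alpha>)))"
    unfolding V_def norm_scaleR cnorm_def using K by (simp add: mult_left_mono norm_sum)
  finally have nz: "norm z \<le> K * (\<Sum>g\<in>G. cnorm (\<Sum>\<alpha>\<in>A. cmul (e \<alpha> g) (b \<alpha>)))" .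
  have "(\<Sum>\<alpha>\<in>A. cnorm (b \<alpha>) powr s) = (\<Sum>k<?N. norm (y k) powr s)"
    unfolding y_def cnorm_def by (rule sum.reindex_bij_betw[OF \<pi>, symmetric])
  then have "(\<Sum>\<alpha>\<in>A. cnorm (b \<alpha>) powr s) powr (1 / s) \<le> M * norm z"
    using concave[OF psum] by simp
  also have "\<dots> \<le> M * (K * (\<Sum>g\<in>G. cnorm (\<Sum>\<alpha>\<in>A. cmul (e \<alpha> g) (b \<alpha>))))"
    using nz M by (rule mult_left_mono)
  finally show ?thesis .
qed

section \<open>Complex scalars and the passage from the ball of Z to the polydisc\<close>

lemma norm_complex_structure: "complex_structure J \<Longrightarrow> norm (J x) = norm x"
  unfolding complex_structure_def by (metis add_0 cos_pi_half scaleR_one scaleR_zero_left sin_pi_half)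

text \<open>The crude factor 2 does no harm: the estimate only serves to show that the supremum in
  \<open>poly_sup_norm\<close> is finite.\<close>

lemma norm_cscale_le:
  assumes "complex_structure J"
  shows "norm (cscale J c x) \<le> 2 * cmod c * norm x"
proof -
  have "norm (cscale J c x) \<le> \<bar>Re c\<bar> * norm x + \<bar>Im c\<bar> * norm x"
    unfolding cscale_def
    using norm_triangle_ineq[of "Re c *\<^sub>R x" "Im c *\<^sub>R J x"] by (simp add: norm_complex_structure[OF assms])
  also have "\<dots> \<le> cmod c * norm x + cmod c * norm x"
    by (intro add_mono mult_right_mono abs_Re_le_cmod abs_Im_le_cmod) auto
  finally show ?thesis by (simp add: mult_ac)
qed

lemma cscale_cscale:
  assumes "complex_structure J"
  shows "cscale J c (cscale J d x) = cscale J (c * d) x"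
proof -
  have "linear J" "J (J x) = - x" using assms by (auto simp: complex_structure_def)
  then show ?thesis by (simp add: cscale_def linear_add linear_scale algebra_simps)
qed

lemma dual_ball_cscale: "\<phi> \<in> dual_ball J \<Longrightarrow> \<phi> (cscale J c x) = c * \<phi> x"
  by (simp add: dual_ball_def cscale_def linear_add linear_scale complex_eq_iff)

lemma clinear_cscale:
  assumes "bounded_clinear_op J U"
  shows "U (cscale J c x) = cmul c (U x)"
proof -
  have "linear U" "U (J x) = cmul \<i> (U x)" using assms by (auto simp: bounded_clinear_op_def)
  then show ?thesis by (simp add: cscale_def cmul_def linear_add linear_scale prod_eq_iff)
qed

text \<open>The multiplier \<open>unit_vec i\<close> is the i-th coordinate projection, which
  unconditionality makes contractive and normalisation of the basis makes exact. Hence the unit ball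
  lies in the polydisc.\<close>

lemma abs_coordinate_le:
  assumes N: "unconditional_norm n N" and z: "z \<in> cvecs n" and i: "i < n"
  shows "cmod (z i) \<le> N z"
proof -
  have u: "unit_vec i \<in> cvecs n" using i by (auto simp: cvecs_def unit_vec_def)
  have "N (\<lambda>j. unit_vec i j * z j) \<le> N z"
    using N z by (simp add: unconditional_norm_def unit_vec_def)
  moreover have "(\<lambda>j. unit_vec i j * z j) = (\<lambda>j. z i * unit_vec i j)" by (auto simp: unit_vec_def)
  moreover have "N (\<lambda>j. z i * unit_vec i j) = cmod (z i)"
    using N u i by (simp add: unconditional_norm_def)
  ultimately show ?thesis by simp
qed

text \<open>A real \<open>SUP\<close> dominates its members only if they are bounded above; the
  polydisc supplies the bound.\<close>

lemma norm_hpoly_le_sup_norm: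
  assumes J: "complex_structure J" and N: "unconditional_norm n N" and w: "w \<in> open_ball_Z n N"
  shows "norm (hpoly J n m a w) \<le> poly_sup_norm n N J m a"
proof -
  have "norm (hpoly J n m a v) \<le> (\<Sum>\<alpha>\<in>multi_indices n m. 2 * norm (a \<alpha>))" if v: "v \<in> open_ball_Z n N" for v
    unfolding hpoly_def
  proof (rule sum_norm_le)
    fix \<alpha>
    have "cmod (monom n \<alpha> v) \<le> 1"
      using v abs_coordinate_le[OF N, of v] by (intro norm_monom_le) (force simp: open_ball_Z_def)
    then have "2 * cmod (monom n \<alpha> v) * norm (a \<alpha>) \<le> 2 * 1 * norm (a \<alpha>)"
      by (intro mult_right_mono mult_left_mono) auto
    with norm_cscale_le[OF J, of "monom n \<alpha> v" "a \<alpha>"]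
    show "norm (cscale J (monom n \<alpha> v) (a \<alpha>)) \<le> 2 * norm (a \<alpha>)" by linarith
  qed
  then have "bdd_above ((\<lambda>w. norm (hpoly J n m a w)) ` open_ball_Z n N)" by (rule bdd_aboveI2)
  then show ?thesis unfolding poly_sup_norm_def using w by (rule cSUP_upper2) simp
qed

lemma hpoly_polydisc_le:
  assumes J: "complex_structure J" and N: "unconditional_norm n N" and z: "z \<in> open_ball_Z n N"
    and v: "\<And>i. i < n \<Longrightarrow> cmod (v i) \<le> 1"
  shows "norm (hpoly J n m (\<lambda>\<alpha>. cscale J (monom n \<alpha> z) (a \<alpha>)) v) \<le> poly_sup_norm n N J m a"
proof -
  \<comment> \<open>Truncated because unconditionality asks for multipliers bounded by 1 at every
    index, while \<open>v\<close> is controlled only below n.\<close>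
  define \<mu> where "\<mu> i = (if i < n then v i else 0)" for i
  have "N (\<lambda>i. \<mu> i * z i) \<le> N z"
    using N z v by (auto simp: unconditional_norm_def open_ball_Z_def \<mu>_def)
  then have "(\<lambda>i. \<mu> i * z i) \<in> open_ball_Z n N"
    using z by (auto simp: open_ball_Z_def cvecs_def)
  moreover have "hpoly J n m (\<lambda>\<alpha>. cscale J (monom n \<alpha> z) (a \<alpha>)) v = hpoly J n m a (\<lambda>i. \<mu> i * z i)"
    unfolding hpoly_def monom_mult cscale_cscale[OF J]
    using monom_cong[of n \<mu> v] by (simp add: \<mu>_def[abs_def])
  ultimately show ?thesis using norm_hpoly_le_sup_norm[OF J N] by simp
qed

text \<open>A norm-one functional turns the vector polynomial into a scalar one with the same bound
  on the polydisc, so the derivative estimate holds uniformly over the dual ball.\<close>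

lemma summing_Euler_sum_le:
  fixes U :: "'x::banach \<Rightarrow> ('r::{banach, ordered_real_vector, lattice}) \<times> 'r"
  assumes sm: "\<And>N (w :: nat \<Rightarrow> 'x). (\<Sum>k<N. cnorm (U (w k)) powr t) powr (1 / t)
       \<le> C * (SUP \<phi>\<in>dual_ball J. (\<Sum>k<N. cmod (\<phi> (w k)) powr 1) powr (1 / 1))"
    and B: "\<And>v. (\<And>i. i < n \<Longrightarrow> cmod (v i) \<le> 1) \<Longrightarrow> norm (hpoly J n m b v) \<le> B"
    and w: "\<And>i. i < n \<Longrightarrow> cmod (w i) \<le> 1"
  shows "(\<Sum>j<n. cnorm (U (\<Sum>\<alpha>\<in>multi_indices n m. cscale J (monom n \<alpha> w) (real (\<alpha> j) *\<^sub>R b \<alpha>))) powr t) powr (1 / t)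
    \<le> \<bar>C\<bar> * (2 ^ m * B)"
proof -
  let ?E = "\<lambda>j. \<Sum>\<alpha>\<in>multi_indices n m. cscale J (monom n \<alpha> w) (real (\<alpha> j) *\<^sub>R b \<alpha>)"
  have le: "(\<Sum>j<n. cmod (\<phi> (?E j)) powr 1) powr (1 / 1) \<le> 2 ^ m * B" if \<phi>: "\<phi> \<in> dual_ball J" for \<phi>
  proof -
    have lin: "linear \<phi>" using \<phi> by (simp add: dual_ball_def)
    have "(\<Sum>j<n. cmod (\<Sum>\<alpha>\<in>multi_indices n m. of_nat (\<alpha> j) * \<phi> (b \<alpha>) * monom n \<alpha> w)) \<le> 2 ^ m * B"
    proof (rule sum_partial_derivatives_le[OF _ w])
      fix v :: "nat \<Rightarrow> complex" assume v: "\<And>i. i < n \<Longrightarrow> cmod (v i) \<le> 1"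
      have "(\<Sum>\<alpha>\<in>multi_indices n m. \<phi> (b \<alpha>) * monom n \<alpha> v) = \<phi> (hpoly J n m b v)"
        by (simp add: hpoly_def linear_sum[OF lin] dual_ball_cscale[OF \<phi>] mult.commute)
      also have "cmod \<dots> \<le> norm (hpoly J n m b v)" using \<phi> by (simp add: dual_ball_def)
      also have "\<dots> \<le> B" using v by (rule B)
      finally show "cmod (\<Sum>\<alpha>\<in>multi_indices n m. \<phi> (b \<alpha>) * monom n \<alpha> v) \<le> B" .
    qed
    moreover have "\<phi> (?E j) = (\<Sum>\<alpha>\<in>multi_indices n m. of_nat (\<alpha> j) * \<phi> (b \<alpha>) * monom n \<alpha> w)" for j
      by (simp add: linear_sum[OF lin] dual_ball_cscale[OF \<phi>] linear_scale[OF lin] scaleR_conv_of_real mult_ac)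
    ultimately show ?thesis by (simp add: sum_nonneg)
  qed
  let ?S = "SUP \<phi>\<in>dual_ball J. (\<Sum>j<n. cmod (\<phi> (?E j)) powr 1) powr (1 / 1)"
  \<comment> \<open>The zero functional makes the supremum nonempty and nonnegative; the latter
    permits replacing \<open>C\<close>, whose sign is unknown, by its absolute value.\<close>
  have zero: "(\<lambda>_. 0) \<in> dual_ball J" by (simp add: dual_ball_def linear_iff)
  then have "?S \<le> 2 ^ m * B" using le by (intro cSUP_least) auto
  moreover have "0 \<le> ?S"
    by (rule cSUP_upper2[OF bdd_aboveI2[OF le] zero]) auto
  ultimately have "C * ?S \<le> \<bar>C\<bar> * (2 ^ m * B)" by (intro mult_mono) auto
  with sm[where N = n and w = ?E] show ?thesis by linarith
qed

theorem mainTheorem11: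
  fixes J :: "'x::banach \<Rightarrow> 'x"
    and U :: "'x \<Rightarrow> ('r::{banach, ordered_real_vector, lattice}) \<times> 'r"
    and s t :: real
  assumes X_complex: "complex_structure J"
    and Y_lattice: "banach_lattice TYPE('r)"
    and s_range: "2 \<le> s"
    and Y_concave: "s_concave s TYPE('r)"
    and t_range: "1 \<le> t" "t \<le> s"
    and U_op: "bounded_clinear_op J U"
    and U_summing: "summing t 1 J U"
  shows "\<exists>C>0. \<forall>(n::nat) (m::nat) (N :: (nat \<Rightarrow> complex) \<Rightarrow> real) (a :: (nat \<Rightarrow> nat) \<Rightarrow> 'x) z.
           1 \<le> n \<longrightarrow> 1 \<le> m \<longrightarrow> unconditional_norm n N \<longrightarrow> z \<in> open_ball_Z n N \<longrightarrow>
           (let \<beta> = real m * s * t / (s + (real m - 1) * t) in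
             (\<Sum>\<alpha>\<in>multi_indices n m. cnorm (cmul (monom n \<alpha> z) (U (a \<alpha>))) powr \<beta>) powr (1 / \<beta>)
               \<le> C ^ m * poly_sup_norm n N J m a)"
proof -
  obtain M\<^sub>0 where M\<^sub>0: "\<And>N (y :: nat \<Rightarrow> 'r) z. lat_psum s N y z \<Longrightarrow>
      (\<Sum>k<N. norm (y k) powr s) powr (1 / s) \<le> M\<^sub>0 * norm z"
    using Y_concave unfolding s_concave_def by blast
  define M where "M = \<bar>M\<^sub>0\<bar>"
  have M0: "M \<ge> 0" by (simp add: M_def)
  have M: "(\<Sum>k<N. norm (y k) powr s) powr (1 / s) \<le> M * norm z"
    if "lat_psum s N y z" for N z and y :: "nat \<Rightarrow> 'r"
    using M\<^sub>0[OF that] mult_right_mono[OF abs_ge_self[of M\<^sub>0] norm_ge_zero[of z]] by (simp add: M_def)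
  obtain C\<^sub>0 where C\<^sub>0: "\<And>N (w :: nat \<Rightarrow> 'x). (\<Sum>k<N. cnorm (U (w k)) powr t) powr (1 / t)
       \<le> C\<^sub>0 * (SUP \<phi>\<in>dual_ball J. (\<Sum>k<N. cmod (\<phi> (w k)) powr 1) powr (1 / 1))"
    using U_summing unfolding summing_def by blast
  define c where "c = M * \<bar>C\<^sub>0\<bar>"
  have c0: "c \<ge> 0" using M0 by (simp add: c_def)
  have linU: "linear U" using U_op by (simp add: bounded_clinear_op_def)
  have main: "(\<Sum>\<alpha>\<in>multi_indices n m. cnorm (cmul (monom n \<alpha> z) (U (a \<alpha>))) powr \<beta>) powr (1 / \<beta>)
      \<le> (4 * (c + 1)) ^ m * poly_sup_norm n N J m a"
    if m: "1 \<le> m" and N: "unconditional_norm n N" and z: "z \<in> open_ball_Z n N"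
      and \<beta>: "\<beta> = real m * s * t / (s + (real m - 1) * t)" for n m N a z \<beta>
  proof -
    let ?I = "multi_indices n m"
    define b where "b \<alpha> = cscale J (monom n \<alpha> z) (a \<alpha>)" for \<alpha>
    define B where "B = poly_sup_norm n N J m a"
    have hB: "norm (hpoly J n m b v) \<le> B" if "\<And>i. i < n \<Longrightarrow> cmod (v i) \<le> 1" for v
      unfolding b_def B_def using that by (rule hpoly_polydisc_le[OF X_complex N z])
    have B0: "B \<ge> 0" using order_trans[OF norm_ge_zero hB[of "\<lambda>_. 0"]] by simp
    define L where "L = 2 * m + 1"
    define G where "G = torus n L"
    have L: "L > 0" "2 * m < L" by (auto simp: L_def)
    have G: "finite G" "card G = L ^ n" using L by (simp_all add: G_def finite_torus card_torus)
    have cardG: "real (card G) > 0" using G L by simp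
    define K where "K = 2 ^ m / real L ^ n"
    have K0: "K \<ge> 0" by (simp add: K_def)
    have khinchine: "sqrt (\<Sum>\<alpha>\<in>?I. (cmod (d \<alpha>))\<^sup>2) \<le> K * (\<Sum>g\<in>G. cmod (\<Sum>\<alpha>\<in>?I. d \<alpha> * monom n \<alpha> g))" for d
      unfolding K_def G_def by (rule torus_khinchine[OF L(2)])
    define E where "E j g = (\<Sum>\<alpha>\<in>?I. cscale J (monom n \<alpha> g) (real (\<alpha> j) *\<^sub>R b \<alpha>))" for j g
    have UE: "U (E j g) = (\<Sum>\<alpha>\<in>?I. cmul (monom n \<alpha> g) (real (\<alpha> j) *\<^sub>R U (b \<alpha>)))" for j g
      by (simp add: E_def linear_sum[OF linU] clinear_cscale[OF U_op] linear_scale[OF linU])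
    \<comment> \<open>The bound that s-concavity gives for the coefficients of the j-th Euler
      derivative; it plays the role of u_j in the mixed norm inequality.\<close>
    define u where "u j = M * (K * (\<Sum>g\<in>G. cnorm (U (E j g))))" for j
    have u0: "u j \<ge> 0" for j
      unfolding u_def using M0 K0 by (intro mult_nonneg_nonneg sum_nonneg) (auto simp: cnorm_def)
    define x where "x \<alpha> = cnorm (U (b \<alpha>))" for \<alpha>
    have x_eq: "x \<alpha> = cnorm (cmul (monom n \<alpha> z) (U (a \<alpha>)))" for \<alpha>
      by (simp add: x_def b_def clinear_cscale[OF U_op])
    have x0: "x \<alpha> \<ge> 0" for \<alpha> by (simp add: x_def cnorm_def)
    have mixed: "(\<Sum>\<alpha>\<in>?I. real (\<alpha> j) / m * x \<alpha> powr s) \<le> u j powr s" for j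
    proof -
      let ?S = "\<Sum>\<alpha>\<in>?I. cnorm (real (\<alpha> j) *\<^sub>R U (b \<alpha>)) powr s"
      \<comment> \<open>Integrality matters: k is 0 or at least 1. The weight \<alpha> j / m is thus
        covered by the s-th power of the factor \<alpha> j produced by differentiation.\<close>
      have "real k / m \<le> real k powr s" for k
      proof (cases "k = 0")
        case False
        have "real k / m \<le> real k powr 1" using m mult_left_mono[of 1 "real m" "real k"] by (simp add: field_simps)
        also have "\<dots> \<le> real k powr s" using False s_range by (intro powr_mono) auto
        finally show ?thesis .
      qed simp
      then have "(\<Sum>\<alpha>\<in>?I. real (\<alpha> j) / m * x \<alpha> powr s) \<le> (\<Sum>\<alpha>\<in>?I. real (\<alpha> j) powr s * x \<alpha> powr s)"
        by (intro sum_mono mult_right_mono) auto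
      also have "\<dots> = ?S"
        using x0 by (simp add: cnorm_scaleR[OF Y_lattice] x_def[symmetric] powr_mult)
      also have "\<dots> = (?S powr (1 / s)) powr s" using s_range by (simp add: powr_powr sum_nonneg)
      also have "\<dots> \<le> u j powr s"
      proof (rule powr_mono2)
        show "?S powr (1 / s) \<le> u j"
          unfolding u_def UE
          by (rule s_concave_cnorm_sum_le[OF Y_lattice s_range M0 M finite_multi_indices G(1) K0 khinchine])
      qed (use s_range in auto)
      finally show ?thesis .
    qed
    have u_sum: "(\<Sum>j<n. u j powr t) \<le> (c * 4 ^ m * B) powr t"
    proof -
      let ?f = "\<lambda>j g. cnorm (U (E j g))"
      have f0: "?f j g \<ge> 0" for j g by (simp add: cnorm_def)
      \<comment> \<open>Convexity of the t-th power moves it inside the average over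
        \<open>G\<close>, so that the sum over j can be taken at each fixed g, where summability
        applies.\<close>
      have "u j powr t \<le> (M * 2 ^ m) powr t * ((\<Sum>g\<in>G. ?f j g powr t) / card G)" for j
      proof -
        have "u j = (M * 2 ^ m) * ((\<Sum>g\<in>G. ?f j g) / card G)" using G by (simp add: u_def K_def)
        then have "u j powr t = (M * 2 ^ m) powr t * ((\<Sum>g\<in>G. ?f j g) / card G) powr t"
          by (simp only: powr_mult)
        also have "\<dots> \<le> (M * 2 ^ m) powr t * ((\<Sum>g\<in>G. ?f j g powr t) / card G)"
          using f0 t_range by (intro mult_left_mono power_mean_sum G) auto
        finally show ?thesis .
      qed
      then have "(\<Sum>j<n. u j powr t) \<le> (\<Sum>j<n. (M * 2 ^ m) powr t * ((\<Sum>g\<in>G. ?f j g powr t) / card G))"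
        by (rule sum_mono)
      also have "\<dots> = (M * 2 ^ m) powr t * ((\<Sum>g\<in>G. \<Sum>j<n. ?f j g powr t) / card G)"
        by (subst sum.swap) (simp add: sum_distrib_left sum_divide_distrib)
      also have "\<dots> \<le> (M * 2 ^ m) powr t * ((\<Sum>g\<in>G. (\<bar>C\<^sub>0\<bar> * (2 ^ m * B)) powr t) / card G)"
      proof (intro mult_left_mono divide_right_mono sum_mono)
        fix g assume g: "g \<in> G"
        let ?T = "\<Sum>j<n. ?f j g powr t"
        have "?T powr (1 / t) \<le> \<bar>C\<^sub>0\<bar> * (2 ^ m * B)"
          unfolding E_def using g L by (intro summing_Euler_sum_le C\<^sub>0 hB) (auto simp: G_def norm_torus)
        then have "(?T powr (1 / t)) powr t \<le> (\<bar>C\<^sub>0\<bar> * (2 ^ m * B)) powr t"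
          using t_range by (intro powr_mono2) auto
        then show "?T \<le> (\<bar>C\<^sub>0\<bar> * (2 ^ m * B)) powr t" using t_range by (simp add: powr_powr sum_nonneg)
      qed auto
      also have "\<dots> = (M * 2 ^ m) powr t * (\<bar>C\<^sub>0\<bar> * (2 ^ m * B)) powr t" using cardG by simp
      also have "\<dots> = ((M * 2 ^ m) * (\<bar>C\<^sub>0\<bar> * (2 ^ m * B))) powr t"
        by (rule powr_mult[symmetric])
      also have "(M * 2 ^ m) * (\<bar>C\<^sub>0\<bar> * (2 ^ m * B)) = c * 4 ^ m * B"
        by (simp add: c_def power_mult_distrib[symmetric])
      finally show ?thesis .
    qed
    have \<beta>0: "\<beta> > 0"
      unfolding \<beta> using m s_range t_range by (intro divide_pos_pos add_pos_nonneg mult_pos_pos) auto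
    have "(\<Sum>\<alpha>\<in>?I. x \<alpha> powr \<beta>) \<le> (\<Sum>j<n. u j powr t) powr (\<beta> / t)"
      by (rule multi_index_mixed_norm[OF _ _ _ \<beta>]) (use m t_range x0 u0 mixed in auto)
    also have "\<dots> \<le> ((c * 4 ^ m * B) powr t) powr (\<beta> / t)"
      using u_sum \<beta>0 t_range by (intro powr_mono2) (auto intro: sum_nonneg)
    also have "\<dots> = (c * 4 ^ m * B) powr \<beta>" using t_range by (simp add: powr_powr)
    finally have "(\<Sum>\<alpha>\<in>?I. x \<alpha> powr \<beta>) powr (1 / \<beta>) \<le> ((c * 4 ^ m * B) powr \<beta>) powr (1 / \<beta>)"
      using \<beta>0 by (intro powr_mono2) (auto intro: sum_nonneg)
    also have "\<dots> = c * 4 ^ m * B" using \<beta>0 c0 B0 by (simp add: powr_powr)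
    \<comment> \<open>The bound has to be an m-th power with a positive base; c itself may be 0 or
      below 1, and m \<ge> 1 gives c \<le> (c+1)^m.\<close>
    also have "\<dots> \<le> (c + 1) ^ m * 4 ^ m * B"
    proof -
      have "c \<le> (c + 1) ^ 1" by simp
      also have "\<dots> \<le> (c + 1) ^ m" using m c0 by (intro power_increasing) auto
      finally show ?thesis using B0 by (intro mult_right_mono) auto
    qed
    also have "\<dots> = (4 * (c + 1)) ^ m * B" by (simp only: power_mult_distrib mult.commute)
    finally show ?thesis unfolding x_eq B_def .
  qed
  show ?thesis
    by (rule exI[of _ "4 * (c + 1)"]) (use c0 main in \<open>auto simp: Let_def\<close>)
qed

end
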